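(* Let $(\mathcal X,\mathcal F)$ be a measurable space and $P$ the Markov kernel of a $\phi$-irreducible Markov chain on $\mathcal X$ with stationary measure $\pi$ and time-reversal $P^*$. Assume that $P(x,\cdot)$, $P^*(x,\cdot)$ ($x\in\mathcal X$) and $\pi$ are absolutely continuous with respect to a common reference measure $\mu$ on $(\mathcal X,\mathcal F)$, with densities $p(x,\cdot)$, $p^*(x,\cdot)$, $\pi(\cdot)$, and that $\{x:\pi(x)=0\}$ is a $\mu$-null set. Let $M_1=M_1(P)$ and $M_2=M_2(P)$ be the first and second Metropolis-Hastings (MH) kernels of $P$. Then: (i) $P+P^*=M_1+M_2$. In particular, $M_2(x,\mathcal X)=1$ for $x\in\mathcal X$. (ii) $M_1$ and $M_2$ are self-adjoint operators on $L^2(\pi)$. (iii) $M_1=M_2=P$ if and only if $P$ is reversible with respect to $\pi$. (iv) $M_i(P)=M_i(P^* )$ for $i=1,2$.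
   Context: $L^2(\pi)$ is the complex Hilbert space with $\langle f,g\rangle_\pi=\int f\overline g\,d\pi$; kernels act by $Kf(x)=\int f(y)K(x,dy)$. The time-reversal $P^*$ is the adjoint of $P$ on $L^2(\pi)$: $\pi(dx)P^*(x,dy)=\pi(dy)P(y,dx)$, with density $p^*(x,y)=\pi(y)p(y,x)/\pi(x)$. $P$ is reversible with respect to $\pi$ if $\pi(dx)P(x,dy)=\pi(dy)P(y,dx)$, i.e. $P=P^*$. MH kernels: let $\alpha_1(x,y)=\min\left(\frac{\pi(y)p(y,x)}{\pi(x)p(x,y)},1\right)$ if $\pi(x)p(x,y)>0$ and $0$ otherwise, $r_1(x)=\int_{y\ne x}(1-\alpha_1(x,y))p(x,y)\,\mu(dy)$, and $$M_1(x,dy)=\min\{p(x,y),p^*(x,y)\}\mu(dy)+r_1(x)\delta_x(dy),\qquad M_2(x,dy)=\max\{p(x,y),p^*(x,y)\}\mu(dy)-r_1(x)\delta_x(dy).$$ $M_2$ need not be a Markov kernel. Equalities of kernels are understood as equalities of operators on $L^2(\pi)$ (equivalently up to null sets).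
   Formalization: M_2(x,X)=1 is stated for every x with π(x)>0, i.e. off the μ-null set {π=0}, where p* is undefined and the claim can fail; π is taken σ-finite and the densities jointly measurable. *)

theory Defs
  imports "HOL-Probability.Probability"
begin

text \<open>
  The measurable space is carried by the reference measure \<open>\<mu>\<close>; a Markov kernel on it is an element
  of \<open>\<mu> \<rightarrow>\<^sub>M prob_algebra \<mu>\<close>, which only depends on \<open>sets \<mu>\<close>.
\<close>

section \<open>Irreducibility, stationarity, time-reversal\<close>

primrec kernel_pow :: "'a measure \<Rightarrow> ('a \<Rightarrow> 'a measure) \<Rightarrow> nat \<Rightarrow> 'a \<Rightarrow> 'a measure" where
  "kernel_pow M P 0 = return M"
| "kernel_pow M P (Suc n) = (\<lambda>x. P x \<bind> kernel_pow M P n)"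

definition phi_irreducible :: "'a measure \<Rightarrow> 'a measure \<Rightarrow> ('a \<Rightarrow> 'a measure) \<Rightarrow> bool" where
  "phi_irreducible M \<phi> P \<longleftrightarrow>
     sets \<phi> = sets M \<and> sigma_finite_measure \<phi> \<and> emeasure \<phi> (space M) \<noteq> 0 \<and>
     (\<forall>A\<in>sets M. emeasure \<phi> A > 0 \<longrightarrow>
        (\<forall>x\<in>space M. \<exists>n\<ge>1. emeasure (kernel_pow M P n x) A > 0))"

definition stationary :: "'a measure \<Rightarrow> ('a \<Rightarrow> 'a measure) \<Rightarrow> bool" where
  "stationary \<pi> P \<longleftrightarrow> (\<forall>A\<in>sets \<pi>. (\<integral>\<^sup>+x. emeasure (P x) A \<partial>\<pi>) = emeasure \<pi> A)"

text \<open>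
  The identity \<open>\<pi>(dx) Q(x,dy) = \<pi>(dy) P(y,dx)\<close> of measures on the product space, evaluated on
  rectangles; for a \<open>\<sigma>\<close>-finite \<open>\<pi>\<close> that is stationary for \<open>P\<close>, rectangles determine both sides.
\<close>

definition time_reversal :: "'a measure \<Rightarrow> ('a \<Rightarrow> 'a measure) \<Rightarrow> ('a \<Rightarrow> 'a measure) \<Rightarrow> bool" where
  "time_reversal \<pi> P Q \<longleftrightarrow>
     (\<forall>A\<in>sets \<pi>. \<forall>B\<in>sets \<pi>.
        (\<integral>\<^sup>+x\<in>A. emeasure (Q x) B \<partial>\<pi>) = (\<integral>\<^sup>+y\<in>B. emeasure (P y) A \<partial>\<pi>))"

definition reversible :: "'a measure \<Rightarrow> ('a \<Rightarrow> 'a measure) \<Rightarrow> bool" where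
  "reversible \<pi> P \<longleftrightarrow> time_reversal \<pi> P P"

section \<open>The space \<open>L\<^sup>2(\<pi>)\<close>\<close>

text \<open>Elements are represented by functions; equality in \<open>L\<^sup>2(\<pi>)\<close> is equality \<open>\<pi>\<close>-almost everywhere.\<close>

definition L2 :: "'a measure \<Rightarrow> ('a \<Rightarrow> complex) set" where
  "L2 \<pi> = {f \<in> borel_measurable \<pi>. integrable \<pi> (\<lambda>x. (cmod (f x))\<^sup>2)}"

definition L2_inner :: "'a measure \<Rightarrow> ('a \<Rightarrow> complex) \<Rightarrow> ('a \<Rightarrow> complex) \<Rightarrow> complex" where
  "L2_inner \<pi> f g = (LINT x|\<pi>. f x * cnj (g x))"

definition L2_norm :: "'a measure \<Rightarrow> ('a \<Rightarrow> complex) \<Rightarrow> real" where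
  "L2_norm \<pi> f = sqrt (LINT x|\<pi>. (cmod (f x))\<^sup>2)"

definition L2_bounded_operator ::
    "'a measure \<Rightarrow> (('a \<Rightarrow> complex) \<Rightarrow> ('a \<Rightarrow> complex)) \<Rightarrow> bool" where
  "L2_bounded_operator \<pi> T \<longleftrightarrow>
     (\<forall>f\<in>L2 \<pi>. T f \<in> L2 \<pi>) \<and>
     (\<forall>f\<in>L2 \<pi>. \<forall>g\<in>L2 \<pi>. (AE x in \<pi>. f x = g x) \<longrightarrow> (AE x in \<pi>. T f x = T g x)) \<and>
     (\<forall>f\<in>L2 \<pi>. \<forall>g\<in>L2 \<pi>. \<forall>a b.
        AE x in \<pi>. T (\<lambda>y. a * f y + b * g y) x = a * T f x + b * T g x) \<and>
     (\<exists>C. \<forall>f\<in>L2 \<pi>. L2_norm \<pi> (T f) \<le> C * L2_norm \<pi> f)"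

definition L2_self_adjoint ::
    "'a measure \<Rightarrow> (('a \<Rightarrow> complex) \<Rightarrow> ('a \<Rightarrow> complex)) \<Rightarrow> bool" where
  "L2_self_adjoint \<pi> T \<longleftrightarrow> L2_bounded_operator \<pi> T \<and>
     (\<forall>f\<in>L2 \<pi>. \<forall>g\<in>L2 \<pi>. L2_inner \<pi> (T f) g = L2_inner \<pi> f (T g))"

section \<open>Signed kernels and their action\<close>

text \<open>
  A pair \<open>(A, B)\<close> of measures stands for the signed measure \<open>A - B\<close>; the two components need not be
  mutually singular.
\<close>

type_synonym 'a signed_kernel = "'a \<Rightarrow> 'a measure \<times> 'a measure"

definition add_measure :: "'a measure \<Rightarrow> 'a measure \<Rightarrow> 'a measure" where
  "add_measure A B = measure_of (space A) (sets A) (\<lambda>E. emeasure A E + emeasure B E)"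

definition signed_of :: "('a \<Rightarrow> 'a measure) \<Rightarrow> 'a signed_kernel" where
  "signed_of K = (\<lambda>x. (K x, null_measure (K x)))"

definition kernel_add :: "'a signed_kernel \<Rightarrow> 'a signed_kernel \<Rightarrow> 'a signed_kernel" where
  "kernel_add K L =
     (\<lambda>x. (add_measure (fst (K x)) (fst (L x)), add_measure (snd (K x)) (snd (L x))))"

definition kernel_mass :: "'a signed_kernel \<Rightarrow> 'a \<Rightarrow> 'a set \<Rightarrow> real" where
  "kernel_mass K x E = measure (fst (K x)) E - measure (snd (K x)) E"

definition kernel_integrable :: "'a signed_kernel \<Rightarrow> ('a \<Rightarrow> complex) \<Rightarrow> 'a \<Rightarrow> bool" where
  "kernel_integrable K f x \<longleftrightarrow> integrable (fst (K x)) f \<and> integrable (snd (K x)) f"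

definition kernel_act :: "'a signed_kernel \<Rightarrow> ('a \<Rightarrow> complex) \<Rightarrow> 'a \<Rightarrow> complex" where
  "kernel_act K f x = (LINT y|fst (K x). f y) - (LINT y|snd (K x). f y)"

text \<open>Equality of kernels as operators on \<open>L\<^sup>2(\<pi>)\<close>.\<close>

definition kernel_eq :: "'a measure \<Rightarrow> 'a signed_kernel \<Rightarrow> 'a signed_kernel \<Rightarrow> bool" where
  "kernel_eq \<pi> K L \<longleftrightarrow>
     (\<forall>f\<in>L2 \<pi>. AE x in \<pi>. kernel_integrable K f x \<and> kernel_integrable L f x \<and>
                          kernel_act K f x = kernel_act L f x)"

text \<open>
  For \<open>f\<close> in \<open>L\<^sup>2(\<pi>)\<close> the integral \<open>\<integral> f(y) K(x,dy)\<close> need only exist for \<open>\<pi>\<close>-almost every \<open>x\<close>, and as a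
  function of \<open>x\<close> it need only agree almost everywhere with a measurable function; \<open>T f\<close> is such a
  representative.
\<close>

definition kernel_induces ::
    "'a measure \<Rightarrow> 'a signed_kernel \<Rightarrow> (('a \<Rightarrow> complex) \<Rightarrow> ('a \<Rightarrow> complex)) \<Rightarrow> bool" where
  "kernel_induces \<pi> K T \<longleftrightarrow>
     (\<forall>f\<in>L2 \<pi>. AE x in \<pi>. kernel_integrable K f x \<and> T f x = kernel_act K f x)"

definition kernel_self_adjoint :: "'a measure \<Rightarrow> 'a signed_kernel \<Rightarrow> bool" where
  "kernel_self_adjoint \<pi> K \<longleftrightarrow> (\<exists>T. kernel_induces \<pi> K T \<and> L2_self_adjoint \<pi> T)"

section \<open>Metropolis-Hastings kernels\<close>

text \<open>
  Throughout, \<open>w\<close> is the density of \<open>\<pi>\<close> and \<open>p\<close> the transition density, both with respect to \<open>\<mu>\<close>.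
  Where \<open>w x = 0\<close>, division by zero makes \<open>reversal_density w p x y\<close> equal to \<open>0\<close>; this concerns
  a null set of points \<open>x\<close> only.
\<close>

definition reversal_density :: "('a \<Rightarrow> real) \<Rightarrow> ('a \<Rightarrow> 'a \<Rightarrow> real) \<Rightarrow> 'a \<Rightarrow> 'a \<Rightarrow> real" where
  "reversal_density w p x y = w y * p y x / w x"

definition MH_accept :: "('a \<Rightarrow> real) \<Rightarrow> ('a \<Rightarrow> 'a \<Rightarrow> real) \<Rightarrow> 'a \<Rightarrow> 'a \<Rightarrow> real" where
  "MH_accept w p x y = (if w x * p x y > 0 then min (w y * p y x / (w x * p x y)) 1 else 0)"

definition MH_reject :: "'a measure \<Rightarrow> ('a \<Rightarrow> real) \<Rightarrow> ('a \<Rightarrow> 'a \<Rightarrow> real) \<Rightarrow> 'a \<Rightarrow> real" where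
  "MH_reject \<mu> w p x = (LINT y:{y\<in>space \<mu>. y \<noteq> x}|\<mu>. (1 - MH_accept w p x y) * p x y)"

definition MH1 :: "'a measure \<Rightarrow> ('a \<Rightarrow> real) \<Rightarrow> ('a \<Rightarrow> 'a \<Rightarrow> real) \<Rightarrow> 'a signed_kernel" where
  "MH1 \<mu> w p = signed_of (\<lambda>x.
     add_measure (density \<mu> (\<lambda>y. ennreal (min (p x y) (reversal_density w p x y))))
                 (scale_measure (ennreal (MH_reject \<mu> w p x)) (return \<mu> x)))"

definition MH2 :: "'a measure \<Rightarrow> ('a \<Rightarrow> real) \<Rightarrow> ('a \<Rightarrow> 'a \<Rightarrow> real) \<Rightarrow> 'a signed_kernel" where
  "MH2 \<mu> w p = (\<lambda>x.
     (density \<mu> (\<lambda>y. ennreal (max (p x y) (reversal_density w p x y))),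
      scale_measure (ennreal (MH_reject \<mu> w p x)) (return \<mu> x)))"

end

theory Submission
  imports Defs
begin

text \<open>
  Everything becomes transparent once densities are taken relative to the stationary measure
  \<open>\<pi> = w \<mu>\<close> instead of \<open>\<mu>\<close>. Put \<open>u x y = p x y / w y\<close>, so that \<open>P(x,dy) = u x y \<pi>(dy)\<close>. Since
  \<open>reversal_density w p x y / w y = u y x\<close>, passing to the time-reversal is nothing but transposing
  \<open>u\<close>. Hence, for every \<open>x\<close> with \<open>w x > 0\<close>, the two Metropolis-Hastings kernels are
  \<open>lo x y \<pi>(dy) + r(x) \<delta>\<^sub>x\<close> and \<open>hi x y \<pi>(dy) - r(x) \<delta>\<^sub>x\<close>, where \<open>lo\<close> and \<open>hi\<close> are the pointwise
  minimum and maximum of \<open>u\<close> and its transpose (\<open>MH1_eq\<close>, \<open>MH2_eq\<close>). The rejection probability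
  \<open>r(x)\<close> is the mass that \<open>lo x\<close> misses, \<open>1 - \<integral> lo x y \<pi>(dy)\<close>.

  The identity \<open>P + P\<^sup>* = M\<^sub>1 + M\<^sub>2\<close> is then \<open>min a b + max a b = a + b\<close>, and it gives \<open>hi x\<close> the mass
  \<open>1 + r(x)\<close>, so that \<open>M\<^sub>2\<close> has total mass one. The kernels do not change when \<open>u\<close> is transposed,
  which is the invariance under \<open>P \<mapsto> P\<^sup>*\<close>.

  Self-adjointness holds because \<open>lo\<close> and \<open>hi\<close> are symmetric functions with bounded row
  integrals: by Schur's test (\<open>int_op_bounded\<close>) such a kernel defines a bounded operator on
  \<open>L\<^sup>2(\<pi>)\<close>, and Fubini's theorem makes it symmetric (\<open>int_op_symmetric\<close>). The Dirac part acts as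
  multiplication by the bounded real function \<open>\<plusminus>r\<close>. The same estimate for \<open>hi\<close>, which dominates \<open>u\<close>
  and its transpose, provides the integrability needed for the action of every kernel involved.

  For the characterization of reversibility, a reversible \<open>P\<close> makes the densities \<open>u\<close> and its
  transpose agree on all rectangles of \<open>\<pi> \<Otimes> \<pi>\<close>, hence almost everywhere; then \<open>lo = hi = u\<close> and
  \<open>r = 0\<close>. Conversely, \<open>M\<^sub>1\<close> is always reversible, and equality with \<open>M\<^sub>1\<close> as operators, tested on
  indicators of sets of finite measure, carries this over to \<open>P\<close>.
\<close>

section \<open>Sums and multiples of measures\<close>

lemma sets_add_measure [simp, measurable_cong]: "sets (add_measure A B) = sets A"
  and space_add_measure [simp]: "space (add_measure A B) = space A"
  by (auto simp: add_measure_def sets.sigma_sets_eq sets.space_closed space_measure_of_conv)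

lemma emeasure_add_measure:
  assumes "sets A = sets B" "E \<in> sets A"
  shows "emeasure (add_measure A B) E = emeasure A E + emeasure B E"
proof (rule emeasure_measure_of[OF add_measure_def])
  show "sets A \<subseteq> Pow (space A)" by (rule sets.space_closed)
  show "E \<in> sets (add_measure A B)" using assms(2) by simp
  show "positive (sets (add_measure A B)) (\<lambda>E. emeasure A E + emeasure B E)"
    by (simp add: positive_def)
  show "countably_additive (sets (add_measure A B)) (\<lambda>E. emeasure A E + emeasure B E)"
    using assms(1)
    by (auto simp: countably_additive_def suminf_add[symmetric] intro!: arg_cong2[where f="(+)"] suminf_emeasure)
qed

lemma nn_integral_add_measure:
  assumes AB: "sets A = sets B" and "f \<in> borel_measurable A"
  shows "(\<integral>\<^sup>+x. f x \<partial>add_measure A B) = (\<integral>\<^sup>+x. f x \<partial>A) + (\<integral>\<^sup>+x. f x \<partial>B)"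
proof -
  have meas: "g \<in> borel_measurable B" "g \<in> borel_measurable (add_measure A B)"
    if "g \<in> borel_measurable A" for g :: "'a \<Rightarrow> ennreal"
    using that measurable_cong_sets[OF AB refl, of borel] by (auto cong: measurable_cong_sets)
  from assms(2) show ?thesis
  proof induction
    case (cong f g)
    then show ?case
      using sets_eq_imp_space_eq[OF AB] by (simp cong: nn_integral_cong_simp)
  next
    case (set E)
    then show ?case using AB by (simp add: emeasure_add_measure)
  next
    case (mult f c)
    have "f \<in> borel_measurable A" using mult by simp
    from this meas[OF this] mult show ?case
      by (simp add: nn_integral_cmult distrib_left)
  next
    case (add f g)
    have "f \<in> borel_measurable A" "g \<in> borel_measurable A" using add by simp_all
    from this meas[OF this(1)] meas[OF this(2)] add show ?case
      by (simp add: nn_integral_add add_ac)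
  next
    case (seq U)
    have B: "U i \<in> borel_measurable B" "U i \<in> borel_measurable (add_measure A B)" for i
      using meas[OF seq(1)] by auto
    have inc: "incseq (\<lambda>i. integral\<^sup>N M (U i))" for M
      using seq(3) by (auto simp: incseq_def le_fun_def intro!: nn_integral_mono)
    show ?case
      using seq B inc
      by (simp add: image_comp nn_integral_monotone_convergence_SUP ennreal_SUP_add)
  qed
qed

lemma integrable_add_measure_iff:
  fixes f :: "'a \<Rightarrow> 'b::{banach, second_countable_topology}"
  assumes "sets A = sets B"
  shows "integrable (add_measure A B) f \<longleftrightarrow> integrable A f \<and> integrable B f"
proof -
  have "f \<in> borel_measurable (add_measure A B) \<longleftrightarrow> f \<in> borel_measurable A"
       "f \<in> borel_measurable B \<longleftrightarrow> f \<in> borel_measurable A"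
    using assms by (auto cong: measurable_cong_sets)
  then show ?thesis
    by (auto simp: integrable_iff_bounded nn_integral_add_measure[OF assms])
qed

lemma integral_add_measure:
  fixes f :: "'a \<Rightarrow> complex"
  assumes AB: "sets A = sets B" and f: "integrable A f" "integrable B f"
  shows "(LINT x|add_measure A B. f x) = (LINT x|A. f x) + (LINT x|B. f x)"
proof -
  have int: "integrable (add_measure A B) f"
    using assms by (simp add: integrable_add_measure_iff)
  have real: "(LINT x|add_measure A B. g x) = (LINT x|A. g x) + (LINT x|B. g x)"
    if g: "integrable A g" "integrable B g" for g :: "'a \<Rightarrow> real"
  proof -
    have "integrable (add_measure A B) g"
      using AB g by (simp add: integrable_add_measure_iff)
    moreover have "(\<integral>\<^sup>+x. ennreal (g x) \<partial>add_measure A B) = (\<integral>\<^sup>+x. ennreal (g x) \<partial>A) + (\<integral>\<^sup>+x. ennreal (g x) \<partial>B)"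
      "(\<integral>\<^sup>+x. ennreal (- g x) \<partial>add_measure A B) = (\<integral>\<^sup>+x. ennreal (- g x) \<partial>A) + (\<integral>\<^sup>+x. ennreal (- g x) \<partial>B)"
      using g(1) by (auto intro!: nn_integral_add_measure[OF AB])
    ultimately show ?thesis
      using g by (simp add: real_lebesgue_integral_def real_integrable_def enn2real_plus top.not_eq_extremum)
  qed
  show ?thesis
    using real[OF integrable_Re[OF f(1)] integrable_Re[OF f(2)]]
      real[OF integrable_Im[OF f(1)] integrable_Im[OF f(2)]] int f
    by (simp add: complex_eq_iff)
qed

text \<open>
  A multiple of a Dirac measure integrates every measurable function by evaluation; the singleton
  \<open>{x}\<close> itself may fail to be measurable.
\<close>

lemma scale_measure_return_integral:
  fixes f :: "'a \<Rightarrow> 'b::{banach, second_countable_topology}"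
  assumes x: "x \<in> space M" and f: "f \<in> borel_measurable M" and r: "0 \<le> r"
  shows "integrable (scale_measure (ennreal r) (return M x)) f"
    and "(LINT y|scale_measure (ennreal r) (return M x). f y) = r *\<^sub>R f x"
proof -
  have dens: "scale_measure (ennreal r) (return M x) = density (return M x) (\<lambda>_. ennreal r)"
    by (rule measure_eqI) (auto simp: emeasure_density nn_integral_cmult_indicator)
  have f': "f \<in> borel_measurable (return M x)" using f by (simp cong: measurable_cong_sets)
  have "integrable (return M x) (\<lambda>y. r *\<^sub>R f y)"
    using x f f' by (intro integrableI_bounded) (auto simp: nn_integral_return)
  then show "integrable (scale_measure (ennreal r) (return M x)) f"
    unfolding dens using r f' by (subst integrable_density) auto
  show "(LINT y|scale_measure (ennreal r) (return M x). f y) = r *\<^sub>R f x"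
    unfolding dens using r f f' x by (subst integral_density) (auto simp: integral_return)
qed

section \<open>Bounded self-adjoint operators on \<open>L\<^sup>2\<close>\<close>

lemma borel_measurable_cnj [measurable (raw)]:
  "f \<in> borel_measurable M \<Longrightarrow> (\<lambda>x. cnj (f x)) \<in> borel_measurable M"
  by (rule borel_measurable_continuous_on[OF continuous_on_cnj[OF continuous_on_id]])

lemma L2_self_adjointD:
  assumes "L2_self_adjoint M T"
  shows "f \<in> L2 M \<Longrightarrow> T f \<in> L2 M"
    and "f \<in> L2 M \<Longrightarrow> g \<in> L2 M \<Longrightarrow> AE x in M. f x = g x \<Longrightarrow> AE x in M. T f x = T g x"
    and "f \<in> L2 M \<Longrightarrow> g \<in> L2 M \<Longrightarrow>
           AE x in M. T (\<lambda>y. a * f y + b * g y) x = a * T f x + b * T g x"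
    and "\<exists>C. \<forall>f\<in>L2 M. L2_norm M (T f) \<le> C * L2_norm M f"
    and "f \<in> L2 M \<Longrightarrow> g \<in> L2 M \<Longrightarrow> L2_inner M (T f) g = L2_inner M f (T g)"
proof -
  note T = assms[unfolded L2_self_adjoint_def L2_bounded_operator_def]
  note maps = T[THEN conjunct1, THEN conjunct1] and cong = T[THEN conjunct1, THEN conjunct2, THEN conjunct1]
    and lin = T[THEN conjunct1, THEN conjunct2, THEN conjunct2, THEN conjunct1]
    and bdd = T[THEN conjunct1, THEN conjunct2, THEN conjunct2, THEN conjunct2]
    and adj = T[THEN conjunct2]
  show "f \<in> L2 M \<Longrightarrow> T f \<in> L2 M" by (rule maps[rule_format])
  show "f \<in> L2 M \<Longrightarrow> g \<in> L2 M \<Longrightarrow> AE x in M. f x = g x \<Longrightarrow> AE x in M. T f x = T g x"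
    by (rule cong[rule_format])
  show "f \<in> L2 M \<Longrightarrow> g \<in> L2 M \<Longrightarrow>
           AE x in M. T (\<lambda>y. a * f y + b * g y) x = a * T f x + b * T g x"
    by (rule lin[rule_format])
  show "\<exists>C. \<forall>f\<in>L2 M. L2_norm M (T f) \<le> C * L2_norm M f" by (rule bdd)
  show "f \<in> L2 M \<Longrightarrow> g \<in> L2 M \<Longrightarrow> L2_inner M (T f) g = L2_inner M f (T g)"
    by (rule adj[rule_format])
qed

lemma L2_measurable [measurable_dest]: "f \<in> L2 M \<Longrightarrow> f \<in> borel_measurable M"
  by (simp add: L2_def)

lemma L2_iff_nn_integral:
  "f \<in> L2 M \<longleftrightarrow> f \<in> borel_measurable M \<and> (\<integral>\<^sup>+x. ennreal ((cmod (f x))\<^sup>2) \<partial>M) < \<infinity>"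
  by (auto simp: L2_def integrable_iff_bounded)

lemma L2_norm_eq_nn_integral:
  "f \<in> L2 M \<Longrightarrow> ennreal ((L2_norm M f)\<^sup>2) = (\<integral>\<^sup>+x. ennreal ((cmod (f x))\<^sup>2) \<partial>M)"
  by (simp add: L2_def L2_norm_def nn_integral_eq_integral)

lemma L2_norm_nonneg: "0 \<le> L2_norm M f"
  by (simp add: L2_norm_def)

lemma L2_bound:
  assumes f: "f \<in> L2 M" and g: "g \<in> borel_measurable M" and G: "0 \<le> G"
    and le: "(\<integral>\<^sup>+x. ennreal ((cmod (g x))\<^sup>2) \<partial>M) \<le> ennreal (G\<^sup>2) * (\<integral>\<^sup>+x. ennreal ((cmod (f x))\<^sup>2) \<partial>M)"
  shows "g \<in> L2 M" and "L2_norm M g \<le> G * L2_norm M f"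
proof -
  have "ennreal (G\<^sup>2) * (\<integral>\<^sup>+x. ennreal ((cmod (f x))\<^sup>2) \<partial>M) < \<infinity>"
    using f by (simp add: L2_iff_nn_integral ennreal_mult_less_top)
  with le show gL: "g \<in> L2 M"
    using g by (simp add: L2_iff_nn_integral)
  have "ennreal ((L2_norm M g)\<^sup>2) \<le> ennreal (G\<^sup>2) * ennreal ((L2_norm M f)\<^sup>2)"
    using le by (simp add: L2_norm_eq_nn_integral f gL)
  then have "(L2_norm M g)\<^sup>2 \<le> (G * L2_norm M f)\<^sup>2"
    by (simp add: ennreal_mult[symmetric] power_mult_distrib)
  then show "L2_norm M g \<le> G * L2_norm M f"
    by (rule power2_le_imp_le) (simp add: G L2_norm_nonneg)
qed

lemma L2_integrable_mult_cnj:
  assumes f: "f \<in> L2 M" and g: "g \<in> L2 M"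
  shows "integrable M (\<lambda>x. f x * cnj (g x))"
proof (rule Bochner_Integration.integrable_bound)
  show "integrable M (\<lambda>x. (cmod (f x))\<^sup>2 + (cmod (g x))\<^sup>2)"
    using f g by (simp add: L2_def)
  show "(\<lambda>x. f x * cnj (g x)) \<in> borel_measurable M"
    using f g by measurable
  have "cmod (f x) * cmod (g x) \<le> (cmod (f x))\<^sup>2 + (cmod (g x))\<^sup>2" for x
    using sum_squares_bound[of "cmod (f x)" "cmod (g x)"] mult_nonneg_nonneg[OF norm_ge_zero norm_ge_zero, of "f x" "g x"]
    by linarith
  then show "AE x in M. norm (f x * cnj (g x)) \<le> norm ((cmod (f x))\<^sup>2 + (cmod (g x))\<^sup>2)"
    by (simp add: norm_mult)
qed

lemma L2_add:
  assumes f: "f \<in> L2 M" and g: "g \<in> L2 M"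
  shows "(\<lambda>x. f x + g x) \<in> L2 M"
    and "(L2_norm M (\<lambda>x. f x + g x))\<^sup>2 \<le> 2 * (L2_norm M f)\<^sup>2 + 2 * (L2_norm M g)\<^sup>2"
proof -
  have le: "(cmod (f x + g x))\<^sup>2 \<le> 2 * (cmod (f x))\<^sup>2 + 2 * (cmod (g x))\<^sup>2" for x
  proof -
    have "(cmod (f x + g x))\<^sup>2 \<le> (cmod (f x) + cmod (g x))\<^sup>2"
      by (simp add: norm_triangle_ineq power_mono)
    also have "\<dots> \<le> 2 * (cmod (f x))\<^sup>2 + 2 * (cmod (g x))\<^sup>2"
      using sum_squares_bound[of "cmod (f x)" "cmod (g x)"] by (simp add: power2_sum)
    finally show ?thesis .
  qed
  have [measurable]: "f \<in> borel_measurable M" "g \<in> borel_measurable M" using f g by auto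
  have int: "integrable M (\<lambda>x. (cmod (f x))\<^sup>2)" "integrable M (\<lambda>x. (cmod (g x))\<^sup>2)"
    using f g by (auto simp: L2_def)
  have int': "integrable M (\<lambda>x. (cmod (f x + g x))\<^sup>2)"
    by (rule Bochner_Integration.integrable_bound[of _ "\<lambda>x. 2 * (cmod (f x))\<^sup>2 + 2 * (cmod (g x))\<^sup>2"])
       (use int le in auto)
  then show "(\<lambda>x. f x + g x) \<in> L2 M" by (simp add: L2_def)
  have "(LINT x|M. (cmod (f x + g x))\<^sup>2) \<le> (LINT x|M. 2 * (cmod (f x))\<^sup>2 + 2 * (cmod (g x))\<^sup>2)"
    by (rule integral_mono) (use int int' le in auto)
  then show "(L2_norm M (\<lambda>x. f x + g x))\<^sup>2 \<le> 2 * (L2_norm M f)\<^sup>2 + 2 * (L2_norm M g)\<^sup>2"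
    using int by (simp add: L2_norm_def)
qed

text \<open>
  Both kernels split into an integral operator and a multiplication operator; their operators are
  self-adjoint because each summand is.
\<close>

lemma L2_self_adjoint_add:
  assumes S: "L2_self_adjoint M S" and T: "L2_self_adjoint M T"
  shows "L2_self_adjoint M (\<lambda>f x. S f x + T f x)"
proof -
  have SL: "S f \<in> L2 M" and TL: "T f \<in> L2 M" if "f \<in> L2 M" for f
    using that by (rule L2_self_adjointD(1)[OF S], rule L2_self_adjointD(1)[OF T])
  have "\<exists>C. \<forall>f\<in>L2 M. L2_norm M (\<lambda>x. S f x + T f x) \<le> C * L2_norm M f"
  proof -
    obtain C where C: "\<And>f. f \<in> L2 M \<Longrightarrow> L2_norm M (S f) \<le> C * L2_norm M f"
      using L2_self_adjointD(4)[OF S] by blast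
    obtain D where D: "\<And>f. f \<in> L2 M \<Longrightarrow> L2_norm M (T f) \<le> D * L2_norm M f"
      using L2_self_adjointD(4)[OF T] by blast
    have "L2_norm M (\<lambda>x. S f x + T f x) \<le> sqrt (2 * C\<^sup>2 + 2 * D\<^sup>2) * L2_norm M f" if f: "f \<in> L2 M" for f
    proof (rule power2_le_imp_le)
      have "(L2_norm M (S f))\<^sup>2 \<le> (C * L2_norm M f)\<^sup>2" "(L2_norm M (T f))\<^sup>2 \<le> (D * L2_norm M f)\<^sup>2"
        using C[OF f] D[OF f] by (auto intro!: power_mono L2_norm_nonneg)
      with L2_add(2)[OF SL[OF f] TL[OF f]]
      show "(L2_norm M (\<lambda>x. S f x + T f x))\<^sup>2 \<le> (sqrt (2 * C\<^sup>2 + 2 * D\<^sup>2) * L2_norm M f)\<^sup>2"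
        by (simp add: power_mult_distrib algebra_simps)
    qed (simp add: L2_norm_nonneg)
    then show ?thesis by blast
  qed
  moreover have "AE x in M. S (\<lambda>y. a * f y + b * g y) x + T (\<lambda>y. a * f y + b * g y) x
      = a * (S f x + T f x) + b * (S g x + T g x)" if "f \<in> L2 M" "g \<in> L2 M" for f g a b
  proof -
    have "AE x in M. S (\<lambda>y. a * f y + b * g y) x = a * S f x + b * S g x"
         "AE x in M. T (\<lambda>y. a * f y + b * g y) x = a * T f x + b * T g x"
      using that by (rule L2_self_adjointD(3)[OF S], rule L2_self_adjointD(3)[OF T])
    then show ?thesis by eventually_elim (simp add: algebra_simps)
  qed
  moreover have "AE x in M. S f x + T f x = S g x + T g x"
    if "f \<in> L2 M" "g \<in> L2 M" "AE x in M. f x = g x" for f g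
  proof -
    have "AE x in M. S f x = S g x" "AE x in M. T f x = T g x"
      using that by (rule L2_self_adjointD(2)[OF S], rule L2_self_adjointD(2)[OF T])
    then show ?thesis by eventually_elim simp
  qed
  moreover have "L2_inner M (\<lambda>x. S f x + T f x) g = L2_inner M f (\<lambda>x. S g x + T g x)"
    if f: "f \<in> L2 M" and g: "g \<in> L2 M" for f g
  proof -
    have "L2_inner M (S f) g = L2_inner M f (S g)" "L2_inner M (T f) g = L2_inner M f (T g)"
      using f g by (rule L2_self_adjointD(5)[OF S], rule L2_self_adjointD(5)[OF T])
    then show ?thesis
      using L2_integrable_mult_cnj[OF SL[OF f] g] L2_integrable_mult_cnj[OF TL[OF f] g]
        L2_integrable_mult_cnj[OF f SL[OF g]] L2_integrable_mult_cnj[OF f TL[OF g]]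
      by (simp add: L2_inner_def distrib_left distrib_right)
  qed
  ultimately show ?thesis
    unfolding L2_self_adjoint_def L2_bounded_operator_def using L2_add(1)[OF SL TL] by simp
qed

lemma L2_self_adjoint_multiplication:
  fixes c :: "'a \<Rightarrow> real"
  assumes c [measurable]: "c \<in> borel_measurable M" and D: "AE x in M. \<bar>c x\<bar> \<le> D"
  shows "L2_self_adjoint M (\<lambda>f x. c x *\<^sub>R f x)"
proof -
  have b: "(\<lambda>x. c x *\<^sub>R f x) \<in> L2 M \<and> L2_norm M (\<lambda>x. c x *\<^sub>R f x) \<le> \<bar>D\<bar> * L2_norm M f"
    if f: "f \<in> L2 M" for f
  proof -
    have [measurable]: "f \<in> borel_measurable M" using f by auto
    have "(\<integral>\<^sup>+x. ennreal ((cmod (c x *\<^sub>R f x))\<^sup>2) \<partial>M) \<le> (\<integral>\<^sup>+x. ennreal (\<bar>D\<bar>\<^sup>2) * ennreal ((cmod (f x))\<^sup>2) \<partial>M)"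
    proof (rule nn_integral_mono_AE, use D in eventually_elim)
      fix x assume "\<bar>c x\<bar> \<le> D"
      then have "(cmod (c x *\<^sub>R f x))\<^sup>2 \<le> \<bar>D\<bar>\<^sup>2 * (cmod (f x))\<^sup>2"
        unfolding power_mult_distrib[symmetric] by (intro power_mono) (auto intro: mult_right_mono)
      then show "ennreal ((cmod (c x *\<^sub>R f x))\<^sup>2) \<le> ennreal (\<bar>D\<bar>\<^sup>2) * ennreal ((cmod (f x))\<^sup>2)"
        by (simp add: ennreal_power ennreal_mult[symmetric])
    qed
    also have "\<dots> = ennreal (\<bar>D\<bar>\<^sup>2) * (\<integral>\<^sup>+x. ennreal ((cmod (f x))\<^sup>2) \<partial>M)"
      by (rule nn_integral_cmult) simp
    finally show ?thesis
      using L2_bound[of f M "\<lambda>x. c x *\<^sub>R f x" "\<bar>D\<bar>"] f by simp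
  qed
  then have "\<exists>C. \<forall>f\<in>L2 M. L2_norm M (\<lambda>x. c x *\<^sub>R f x) \<le> C * L2_norm M f"
    by blast
  moreover have "AE x in M. c x *\<^sub>R f x = c x *\<^sub>R g x" if "AE x in M. f x = g x" for f g :: "'a \<Rightarrow> complex"
    using that by eventually_elim simp
  moreover have "L2_inner M (\<lambda>x. c x *\<^sub>R f x) g = L2_inner M f (\<lambda>x. c x *\<^sub>R g x)" for f g
    by (simp add: L2_inner_def)
  ultimately show ?thesis
    unfolding L2_self_adjoint_def L2_bounded_operator_def using b by (simp add: scaleR_right_distrib)
qed

section \<open>Symmetric kernels of bounded row mass\<close>

locale symmetric_kernel = sigma_finite_measure M for M :: "'a measure" +
  fixes h :: "'a \<Rightarrow> 'a \<Rightarrow> real" and C :: real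
  assumes h_measurable [measurable]: "(\<lambda>(x, y). h x y) \<in> borel_measurable (M \<Otimes>\<^sub>M M)"
    and h_nonneg: "x \<in> space M \<Longrightarrow> y \<in> space M \<Longrightarrow> 0 \<le> h x y"
    and h_sym: "h x y = h y x"
    and C_nonneg: "0 \<le> C"
    and row_mass: "AE x in M. (\<integral>\<^sup>+y. ennreal (h x y) \<partial>M) \<le> ennreal C"
begin

sublocale pair: pair_sigma_finite M M ..

definition int_op :: "('a \<Rightarrow> complex) \<Rightarrow> 'a \<Rightarrow> complex" where
  "int_op f x = (LINT y|M. h x y *\<^sub>R f y)"

lemma int_op_measurable [measurable]:
  assumes [measurable]: "f \<in> borel_measurable M"
  shows "int_op f \<in> borel_measurable M"
  unfolding int_op_def by measurable

lemma row_measurable: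
  assumes "x \<in> space M"
  shows "h x \<in> borel_measurable M"
  using measurable_compose[OF measurable_Pair1'[OF assms] h_measurable] by simp

text \<open>
  By symmetry the column integrals obey the same bound as the row integrals, so Tonelli's theorem
  bounds the mass of the kernel applied to a nonnegative function.
\<close>

lemma nn_integral_kernel_le:
  assumes [measurable]: "g \<in> borel_measurable M"
  shows "(\<integral>\<^sup>+x. (\<integral>\<^sup>+y. ennreal (h x y) * g y \<partial>M) \<partial>M) \<le> ennreal C * (\<integral>\<^sup>+y. g y \<partial>M)"
proof -
  have "(\<integral>\<^sup>+x. (\<integral>\<^sup>+y. ennreal (h x y) * g y \<partial>M) \<partial>M) = (\<integral>\<^sup>+y. (\<integral>\<^sup>+x. ennreal (h x y) * g y \<partial>M) \<partial>M)"
    by (rule pair.Fubini'[symmetric]) measurable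
  also have "\<dots> = (\<integral>\<^sup>+y. (\<integral>\<^sup>+x. ennreal (h y x) \<partial>M) * g y \<partial>M)"
    using row_measurable by (intro nn_integral_cong) (simp add: h_sym[of _ y for y] nn_integral_multc)
  also have "\<dots> \<le> (\<integral>\<^sup>+y. ennreal C * g y \<partial>M)"
    by (rule nn_integral_mono_AE, use row_mass in eventually_elim) (rule mult_right_mono, auto)
  finally show ?thesis
    by (simp add: nn_integral_cmult)
qed

lemma finite_energy:
  assumes f: "f \<in> L2 M"
  shows "(\<integral>\<^sup>+x. (\<integral>\<^sup>+y. ennreal (h x y) * ennreal ((cmod (f y))\<^sup>2) \<partial>M) \<partial>M) < \<infinity>"
proof -
  have [measurable]: "f \<in> borel_measurable M" using f by auto
  show ?thesis
    by (rule le_less_trans[OF nn_integral_kernel_le])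
       (use f in \<open>simp_all add: L2_iff_nn_integral ennreal_mult_less_top\<close>)
qed

text \<open>
  Cauchy-Schwarz after splitting the kernel as \<open>sqrt (h x y) * sqrt (h x y)\<close>, the pointwise half of
  Schur's test.
\<close>

lemma row_bound:
  assumes f [measurable]: "f \<in> borel_measurable M" and x: "x \<in> space M"
  shows "(\<integral>\<^sup>+y. ennreal (cmod (h x y *\<^sub>R f y)) \<partial>M)\<^sup>2
     \<le> (\<integral>\<^sup>+y. ennreal (h x y) \<partial>M) * (\<integral>\<^sup>+y. ennreal (h x y) * ennreal ((cmod (f y))\<^sup>2) \<partial>M)"
proof -
  note [measurable] = row_measurable[OF x]
  have "(\<integral>\<^sup>+y. ennreal (cmod (h x y *\<^sub>R f y)) \<partial>M)
      = (\<integral>\<^sup>+y. ennreal (sqrt (h x y)) * ennreal (sqrt (h x y) * cmod (f y)) \<partial>M)"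
    using h_nonneg[OF x] by (intro nn_integral_cong) (simp add: ennreal_mult[symmetric] mult.assoc[symmetric])
  also have "\<dots>\<^sup>2 \<le> (\<integral>\<^sup>+y. (ennreal (sqrt (h x y)))\<^sup>2 \<partial>M) * (\<integral>\<^sup>+y. (ennreal (sqrt (h x y) * cmod (f y)))\<^sup>2 \<partial>M)"
    by (rule Cauchy_Schwarz_nn_integral) measurable
  also have "(\<integral>\<^sup>+y. (ennreal (sqrt (h x y)))\<^sup>2 \<partial>M) = (\<integral>\<^sup>+y. ennreal (h x y) \<partial>M)"
    using h_nonneg[OF x] by (intro nn_integral_cong) (simp add: ennreal_power)
  also have "(\<integral>\<^sup>+y. (ennreal (sqrt (h x y) * cmod (f y)))\<^sup>2 \<partial>M)
      = (\<integral>\<^sup>+y. ennreal (h x y) * ennreal ((cmod (f y))\<^sup>2) \<partial>M)"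
    using h_nonneg[OF x]
    by (intro nn_integral_cong) (simp add: ennreal_power power_mult_distrib ennreal_mult)
  finally show ?thesis .
qed

lemma row_integrable:
  assumes f: "f \<in> L2 M"
  shows "AE x in M. integrable M (\<lambda>y. h x y *\<^sub>R f y)"
proof -
  have [measurable]: "f \<in> borel_measurable M" using f by auto
  have "AE x in M. (\<integral>\<^sup>+y. ennreal (h x y) * ennreal ((cmod (f y))\<^sup>2) \<partial>M) \<noteq> \<infinity>"
    using finite_energy[OF f] by (intro nn_integral_PInf_AE) auto
  then show ?thesis
    using row_mass AE_space
  proof eventually_elim
    case (elim x)
    note [measurable] = row_measurable[OF elim(3)]
    have "(\<integral>\<^sup>+y. ennreal (h x y) \<partial>M) < \<infinity>"
      using elim(2) by (rule le_less_trans) simp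
    with elim(1) have "(\<integral>\<^sup>+y. ennreal (cmod (h x y *\<^sub>R f y)) \<partial>M)\<^sup>2 < \<infinity>"
      by (intro le_less_trans[OF row_bound[OF _ elim(3)]]) (auto simp: ennreal_mult_less_top top.not_eq_extremum)
    then show ?case
      by (simp add: integrable_iff_bounded power_less_top_ennreal)
  qed
qed

text \<open>
  Schur's test: for the squared norms, \<open>row_bound\<close> costs one factor \<open>C\<close> and integrating it by
  \<open>nn_integral_kernel_le\<close> another, which makes \<open>C\<close> the bound of the operator.
\<close>

lemma int_op_bounded:
  assumes f: "f \<in> L2 M"
  shows "int_op f \<in> L2 M" and "L2_norm M (int_op f) \<le> C * L2_norm M f"
proof -
  have [measurable]: "f \<in> borel_measurable M" using f by auto
  have "(\<integral>\<^sup>+x. ennreal ((cmod (int_op f x))\<^sup>2) \<partial>M)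
      \<le> (\<integral>\<^sup>+x. ennreal C * (\<integral>\<^sup>+y. ennreal (h x y) * ennreal ((cmod (f y))\<^sup>2) \<partial>M) \<partial>M)"
  proof (rule nn_integral_mono_AE, use row_integrable[OF f] row_mass AE_space in eventually_elim)
    case (elim x)
    have "ennreal ((cmod (int_op f x))\<^sup>2) \<le> (\<integral>\<^sup>+y. ennreal (cmod (h x y *\<^sub>R f y)) \<partial>M)\<^sup>2"
      unfolding int_op_def ennreal_power[OF norm_ge_zero, symmetric]
      by (rule power_mono[OF integral_norm_bound_ennreal[OF elim(1)]]) simp
    also have "\<dots> \<le> (\<integral>\<^sup>+y. ennreal (h x y) \<partial>M) * (\<integral>\<^sup>+y. ennreal (h x y) * ennreal ((cmod (f y))\<^sup>2) \<partial>M)"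
      by (rule row_bound[OF _ elim(3)]) measurable
    also have "\<dots> \<le> ennreal C * (\<integral>\<^sup>+y. ennreal (h x y) * ennreal ((cmod (f y))\<^sup>2) \<partial>M)"
      by (rule mult_right_mono[OF elim(2)]) simp
    finally show ?case .
  qed
  also have "\<dots> = ennreal C * (\<integral>\<^sup>+x. (\<integral>\<^sup>+y. ennreal (h x y) * ennreal ((cmod (f y))\<^sup>2) \<partial>M) \<partial>M)"
    by (rule nn_integral_cmult) measurable
  also have "\<dots> \<le> ennreal C * (ennreal C * (\<integral>\<^sup>+y. ennreal ((cmod (f y))\<^sup>2) \<partial>M))"
    by (intro mult_left_mono nn_integral_kernel_le) auto
  also have "\<dots> = ennreal (C\<^sup>2) * (\<integral>\<^sup>+y. ennreal ((cmod (f y))\<^sup>2) \<partial>M)"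
    using C_nonneg by (simp add: power2_eq_square ennreal_mult mult.assoc)
  finally have le: "(\<integral>\<^sup>+x. ennreal ((cmod (int_op f x))\<^sup>2) \<partial>M)
      \<le> ennreal (C\<^sup>2) * (\<integral>\<^sup>+y. ennreal ((cmod (f y))\<^sup>2) \<partial>M)" .
  have meas: "int_op f \<in> borel_measurable M" by measurable
  show "int_op f \<in> L2 M" "L2_norm M (int_op f) \<le> C * L2_norm M f"
    by (rule L2_bound[OF f meas C_nonneg le])+
qed

text \<open>
  Justifies Fubini's theorem for the sesquilinear form of the kernel: the integrand is dominated
  through \<open>\<bar>a\<bar> \<bar>b\<bar> \<le> \<bar>a\<bar>\<^sup>2 + \<bar>b\<bar>\<^sup>2\<close>, and both squares have finite energy.
\<close>

lemma integrable_bilinear: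
  assumes f: "f \<in> L2 M" and g: "g \<in> L2 M"
  shows "integrable (M \<Otimes>\<^sub>M M) (\<lambda>(x, y). h x y *\<^sub>R f y * cnj (g x))"
proof (rule integrableI_bounded)
  have [measurable]: "f \<in> borel_measurable M" "g \<in> borel_measurable M" using f g by auto
  show [measurable]: "(\<lambda>(x, y). h x y *\<^sub>R f y * cnj (g x)) \<in> borel_measurable (M \<Otimes>\<^sub>M M)"
    by measurable
  have "(\<integral>\<^sup>+z. ennreal (norm (case z of (x, y) \<Rightarrow> h x y *\<^sub>R f y * cnj (g x))) \<partial>(M \<Otimes>\<^sub>M M))
      \<le> (\<integral>\<^sup>+z. ennreal (h (fst z) (snd z)) * ennreal ((cmod (f (snd z)))\<^sup>2)
              + ennreal (h (fst z) (snd z)) * ennreal ((cmod (g (fst z)))\<^sup>2) \<partial>(M \<Otimes>\<^sub>M M))"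
  proof (rule nn_integral_mono)
    fix z assume "z \<in> space (M \<Otimes>\<^sub>M M)"
    then have h0: "0 \<le> h (fst z) (snd z)"
      by (auto simp: space_pair_measure intro: h_nonneg)
    have "cmod (f (snd z)) * cmod (g (fst z)) \<le> (cmod (f (snd z)))\<^sup>2 + (cmod (g (fst z)))\<^sup>2"
      using sum_squares_bound[of "cmod (f (snd z))" "cmod (g (fst z))"]
        mult_nonneg_nonneg[OF norm_ge_zero norm_ge_zero, of "f (snd z)" "g (fst z)"] by linarith
    from mult_left_mono[OF this h0] h0
    have "norm (case z of (x, y) \<Rightarrow> h x y *\<^sub>R f y * cnj (g x))
        \<le> h (fst z) (snd z) * (cmod (f (snd z)))\<^sup>2 + h (fst z) (snd z) * (cmod (g (fst z)))\<^sup>2"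
      by (simp add: case_prod_beta norm_mult distrib_left mult.assoc)
    then show "ennreal (norm (case z of (x, y) \<Rightarrow> h x y *\<^sub>R f y * cnj (g x)))
        \<le> ennreal (h (fst z) (snd z)) * ennreal ((cmod (f (snd z)))\<^sup>2)
              + ennreal (h (fst z) (snd z)) * ennreal ((cmod (g (fst z)))\<^sup>2)"
      using h0 by (simp add: ennreal_mult[symmetric] ennreal_plus[symmetric] del: ennreal_plus)
  qed
  also have "\<dots> = (\<integral>\<^sup>+z. ennreal (h (fst z) (snd z)) * ennreal ((cmod (f (snd z)))\<^sup>2) \<partial>(M \<Otimes>\<^sub>M M))
      + (\<integral>\<^sup>+z. ennreal (h (fst z) (snd z)) * ennreal ((cmod (g (fst z)))\<^sup>2) \<partial>(M \<Otimes>\<^sub>M M))"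
    by (rule nn_integral_add) measurable
  also have "(\<integral>\<^sup>+z. ennreal (h (fst z) (snd z)) * ennreal ((cmod (f (snd z)))\<^sup>2) \<partial>(M \<Otimes>\<^sub>M M))
      = (\<integral>\<^sup>+x. (\<integral>\<^sup>+y. ennreal (h x y) * ennreal ((cmod (f y))\<^sup>2) \<partial>M) \<partial>M)"
    using nn_integral_fst[of "\<lambda>z. ennreal (h (fst z) (snd z)) * ennreal ((cmod (f (snd z)))\<^sup>2)" M] by simp
  also have "(\<integral>\<^sup>+z. ennreal (h (fst z) (snd z)) * ennreal ((cmod (g (fst z)))\<^sup>2) \<partial>(M \<Otimes>\<^sub>M M))
      = (\<integral>\<^sup>+y. (\<integral>\<^sup>+x. ennreal (h x y) * ennreal ((cmod (g x))\<^sup>2) \<partial>M) \<partial>M)"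
    using pair.nn_integral_snd[of "\<lambda>z. ennreal (h (fst z) (snd z)) * ennreal ((cmod (g (fst z)))\<^sup>2)"]
    by simp
  finally show "(\<integral>\<^sup>+z. ennreal (norm (case z of (x, y) \<Rightarrow> h x y *\<^sub>R f y * cnj (g x))) \<partial>(M \<Otimes>\<^sub>M M)) < \<infinity>"
    using finite_energy[OF f] finite_energy[OF g] by (auto simp: h_sym intro: le_less_trans)
qed

lemma int_op_symmetric:
  assumes f: "f \<in> L2 M" and g: "g \<in> L2 M"
  shows "L2_inner M (int_op f) g = L2_inner M f (int_op g)"
proof -
  have [measurable]: "f \<in> borel_measurable M" "g \<in> borel_measurable M" using f g by auto
  have "L2_inner M (int_op f) g = (LINT x|M. LINT y|M. h x y *\<^sub>R f y * cnj (g x))"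
    unfolding L2_inner_def int_op_def
    by (simp only: integral_mult_left_zero)
  also have "\<dots> = (LINT y|M. LINT x|M. h x y *\<^sub>R f y * cnj (g x))"
    by (rule pair.Fubini_integral[OF integrable_bilinear[OF f g], symmetric])
  also have "\<dots> = L2_inner M f (int_op g)"
    unfolding L2_inner_def int_op_def
  proof (rule Bochner_Integration.integral_cong[OF refl])
    fix y
    have "(LINT x|M. h x y *\<^sub>R f y * cnj (g x)) = (LINT x|M. f y * cnj (h y x *\<^sub>R g x))"
      by (intro Bochner_Integration.integral_cong) (simp_all add: h_sym[of y] mult_ac)
    also have "\<dots> = f y * cnj (LINT x|M. h y x *\<^sub>R g x)"
      by (simp only: integral_mult_right_zero Bochner_Integration.integral_cnj)
    finally show "(LINT x|M. h x y *\<^sub>R f y * cnj (g x)) = f y * cnj (LINT x|M. h y x *\<^sub>R g x)" .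
  qed
  finally show ?thesis .
qed

lemma int_op_self_adjoint: "L2_self_adjoint M int_op"
proof -
  have "AE x in M. int_op f x = int_op g x" if "f \<in> L2 M" "g \<in> L2 M" "AE x in M. f x = g x" for f g
  proof (use AE_space in eventually_elim)
    case (elim x)
    note [measurable] = row_measurable[OF elim]
    have [measurable]: "f \<in> borel_measurable M" "g \<in> borel_measurable M" using that by auto
    have "AE y in M. h x y *\<^sub>R f y = h x y *\<^sub>R g y"
      using that(3) by eventually_elim simp
    then show ?case
      unfolding int_op_def by (intro integral_cong_AE) measurable
  qed
  moreover have "AE x in M. int_op (\<lambda>y. a * f y + b * g y) x = a * int_op f x + b * int_op g x"
    if f: "f \<in> L2 M" and g: "g \<in> L2 M" for f g a b
    using row_integrable[OF f] row_integrable[OF g]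
  proof eventually_elim
    case (elim x)
    have "int_op (\<lambda>y. a * f y + b * g y) x = (LINT y|M. a * (h x y *\<^sub>R f y) + b * (h x y *\<^sub>R g y))"
      by (simp add: int_op_def scaleR_right_distrib)
    also have "\<dots> = a * int_op f x + b * int_op g x"
      unfolding int_op_def
      by (subst Bochner_Integration.integral_add)
         (use elim in \<open>simp_all only: integral_mult_right_zero integrable_mult_right\<close>)
    finally show ?case .
  qed
  ultimately show ?thesis
    unfolding L2_self_adjoint_def L2_bounded_operator_def
    using int_op_bounded int_op_symmetric by (intro conjI exI[of _ C]) simp_all
qed

end

section \<open>Kernels and the operators they induce\<close>

text \<open>
  Reduces equality of kernels, which also demands integrability of both sides, to a computation
  with operators that are already known to be induced.
\<close>

lemma kernel_eq_iff_induced: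
  assumes K: "kernel_induces M K S" and L: "kernel_induces M L T"
  shows "kernel_eq M K L \<longleftrightarrow> (\<forall>f\<in>L2 M. AE x in M. S f x = T f x)"
  unfolding kernel_eq_def
proof (intro ball_cong refl)
  fix f assume f: "f \<in> L2 M"
  have "AE x in M. kernel_integrable K f x \<and> S f x = kernel_act K f x"
    and "AE x in M. kernel_integrable L f x \<and> T f x = kernel_act L f x"
    using K L f by (auto simp: kernel_induces_def)
  then have "AE x in M. (kernel_integrable K f x \<and> kernel_integrable L f x \<and>
      kernel_act K f x = kernel_act L f x) = (S f x = T f x)"
    by eventually_elim auto
  then show "(AE x in M. kernel_integrable K f x \<and> kernel_integrable L f x \<and>
      kernel_act K f x = kernel_act L f x) = (AE x in M. S f x = T f x)"
    by (rule eventually_cong)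
qed

lemma kernel_induces_add:
  assumes K: "kernel_induces M K S" and L: "kernel_induces M L T"
    and sets: "AE x in M. sets (fst (K x)) = sets (fst (L x)) \<and> sets (snd (K x)) = sets (snd (L x))"
  shows "kernel_induces M (kernel_add K L) (\<lambda>f x. S f x + T f x)"
  unfolding kernel_induces_def
proof
  fix f assume f: "f \<in> L2 M"
  have "AE x in M. kernel_integrable K f x \<and> S f x = kernel_act K f x"
    and "AE x in M. kernel_integrable L f x \<and> T f x = kernel_act L f x"
    using K L f by (auto simp: kernel_induces_def)
  then show "AE x in M. kernel_integrable (kernel_add K L) f x \<and>
      S f x + T f x = kernel_act (kernel_add K L) f x"
    using sets
    by eventually_elim
       (simp add: kernel_integrable_def kernel_act_def kernel_add_def integrable_add_measure_iff
          integral_add_measure)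
qed

lemma kernel_eq_sym:
  assumes "kernel_eq M K L"
  shows "kernel_eq M L K"
  unfolding kernel_eq_def
proof
  fix f assume f: "f \<in> L2 M"
  show "AE x in M. kernel_integrable L f x \<and> kernel_integrable K f x \<and> kernel_act L f x = kernel_act K f x"
    using assms[unfolded kernel_eq_def, THEN bspec, OF f] by eventually_elim simp
qed

lemma kernel_eq_trans:
  assumes "kernel_eq M K L" "kernel_eq M L N"
  shows "kernel_eq M K N"
  unfolding kernel_eq_def
proof
  fix f assume f: "f \<in> L2 M"
  show "AE x in M. kernel_integrable K f x \<and> kernel_integrable N f x \<and> kernel_act K f x = kernel_act N f x"
    using assms[unfolded kernel_eq_def, THEN bspec, OF f]
    by eventually_elim simp
qed

lemma nn_integral_as_mass:
  "g \<in> borel_measurable N \<Longrightarrow> (\<integral>\<^sup>+y. g y \<partial>N) = emeasure (density N g) (space N)"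
  by (simp add: emeasure_density cong: nn_integral_cong_simp)

section \<open>Transition densities relative to the stationary measure\<close>

text \<open>
  The two mass conditions say that \<open>p\<close> and its time-reversal are Markov densities. Being symmetric
  under time-reversal, they allow the locale to be instantiated with either of the two densities,
  and what is proved for one holds for the other.
\<close>

locale transition_density =
  fixes \<mu> :: "'a measure" and w :: "'a \<Rightarrow> real" and p :: "'a \<Rightarrow> 'a \<Rightarrow> real"
  assumes pi_sigma_finite: "sigma_finite_measure (density \<mu> (\<lambda>x. ennreal (w x)))"
    and w_measurable [measurable]: "w \<in> borel_measurable \<mu>"
    and w_nonneg: "x \<in> space \<mu> \<Longrightarrow> 0 \<le> w x"
    and w_null: "{x \<in> space \<mu>. w x = 0} \<in> null_sets \<mu>"
    and p_measurable [measurable]: "(\<lambda>(x, y). p x y) \<in> borel_measurable (\<mu> \<Otimes>\<^sub>M \<mu>)"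
    and p_nonneg: "x \<in> space \<mu> \<Longrightarrow> y \<in> space \<mu> \<Longrightarrow> 0 \<le> p x y"
    and mass_out: "x \<in> space \<mu> \<Longrightarrow> 0 < w x \<Longrightarrow> (\<integral>\<^sup>+y. ennreal (p x y) \<partial>\<mu>) = 1"
    and mass_in: "x \<in> space \<mu> \<Longrightarrow> 0 < w x \<Longrightarrow> (\<integral>\<^sup>+y. ennreal (reversal_density w p x y) \<partial>\<mu>) = 1"
begin

definition stat :: "'a measure" where
  "stat = density \<mu> (\<lambda>x. ennreal (w x))"

text \<open>
  The transition density relative to the stationary measure. Its transpose is that of the
  time-reversal.
\<close>

definition u :: "'a \<Rightarrow> 'a \<Rightarrow> real" where
  "u x y = p x y / w y"

definition lo :: "'a \<Rightarrow> 'a \<Rightarrow> real" where "lo x y = min (u x y) (u y x)"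

definition hi :: "'a \<Rightarrow> 'a \<Rightarrow> real" where "hi x y = max (u x y) (u y x)"

text \<open>
  The rejection probability, expressed through \<open>lo\<close> so that it is measurable on the whole space;
  \<open>MH_reject_eq\<close> identifies it where \<open>w\<close> is positive.
\<close>

definition rej :: "'a \<Rightarrow> real" where "rej x = 1 - (LINT y|stat. lo x y)"

lemma sets_stat [simp, measurable_cong]: "sets stat = sets \<mu>"
  and space_stat [simp]: "space stat = space \<mu>"
  by (simp_all add: stat_def)

sublocale stat: sigma_finite_measure stat
  unfolding stat_def by (rule pi_sigma_finite)

lemma AE_w_pos: "AE x in \<mu>. 0 < w x"
  using AE_not_in[OF w_null] AE_space
  by eventually_elim (use w_nonneg in \<open>force simp: less_le\<close>)

lemma AE_stat_pos: "AE x in stat. x \<in> space \<mu> \<and> 0 < w x"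
  unfolding stat_def using AE_w_pos by (subst AE_density) (auto elim!: AE_mp intro!: AE_I2)

lemma p_row [measurable]: "x \<in> space \<mu> \<Longrightarrow> p x \<in> borel_measurable \<mu>"
  using measurable_compose[OF measurable_Pair1' p_measurable, of x] by simp

lemma p_column [measurable]: "x \<in> space \<mu> \<Longrightarrow> (\<lambda>y. p y x) \<in> borel_measurable \<mu>"
  using measurable_compose[OF measurable_Pair2' p_measurable, of x] by simp

lemma u_measurable [measurable]: "(\<lambda>(x, y). u x y) \<in> borel_measurable (stat \<Otimes>\<^sub>M stat)"
  unfolding u_def by measurable

lemma u_row [measurable]: "x \<in> space \<mu> \<Longrightarrow> u x \<in> borel_measurable stat"
  and u_column [measurable]: "x \<in> space \<mu> \<Longrightarrow> (\<lambda>y. u y x) \<in> borel_measurable stat"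
  unfolding u_def by measurable

lemma u_nonneg: "x \<in> space \<mu> \<Longrightarrow> y \<in> space \<mu> \<Longrightarrow> 0 \<le> u x y"
  by (simp add: u_def p_nonneg w_nonneg)

lemma lo_nonneg: "x \<in> space \<mu> \<Longrightarrow> y \<in> space \<mu> \<Longrightarrow> 0 \<le> lo x y"
  and hi_nonneg: "x \<in> space \<mu> \<Longrightarrow> y \<in> space \<mu> \<Longrightarrow> 0 \<le> hi x y"
  by (auto simp: lo_def hi_def u_nonneg le_max_iff_disj)

lemma lo_row [measurable]: "x \<in> space \<mu> \<Longrightarrow> lo x \<in> borel_measurable stat"
  and hi_row [measurable]: "x \<in> space \<mu> \<Longrightarrow> hi x \<in> borel_measurable stat"
  unfolding lo_def hi_def by measurable

lemma density_stat:
  assumes f [measurable]: "f \<in> borel_measurable \<mu>"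
  shows "density \<mu> (\<lambda>y. ennreal (f y)) = density stat (\<lambda>y. ennreal (f y / w y))"
proof -
  have "density stat (\<lambda>y. ennreal (f y / w y)) = density \<mu> (\<lambda>y. ennreal (w y) * ennreal (f y / w y))"
    unfolding stat_def by (rule density_density_eq) measurable
  also have "\<dots> = density \<mu> (\<lambda>y. ennreal (f y))"
  proof (rule density_cong)
    show "AE y in \<mu>. ennreal (w y) * ennreal (f y / w y) = ennreal (f y)"
      using AE_w_pos by eventually_elim (simp add: ennreal_mult'[symmetric])
  qed measurable
  finally show ?thesis ..
qed

text \<open>
  Time-reversal is transposition of \<open>u\<close>.
\<close>

lemma reversal_density_div:
  assumes "0 < w x" "0 < w y"
  shows "reversal_density w p x y / w y = u y x"
  using assms by (simp add: reversal_density_def u_def)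

lemma density_forward: "x \<in> space \<mu> \<Longrightarrow> density \<mu> (\<lambda>y. ennreal (p x y)) = density stat (\<lambda>y. ennreal (u x y))"
  unfolding u_def by (rule density_stat) measurable

lemma reversal_row [measurable]:
  "x \<in> space \<mu> \<Longrightarrow> reversal_density w p x \<in> borel_measurable \<mu>"
  unfolding reversal_density_def by measurable

lemma AE_stat_w_pos: "AE y in stat. 0 < w y"
  using AE_stat_pos by eventually_elim simp

lemma
  assumes x: "x \<in> space \<mu>" "0 < w x"
  shows density_backward:
      "density \<mu> (\<lambda>y. ennreal (reversal_density w p x y)) = density stat (\<lambda>y. ennreal (u y x))"
    and density_lo:
      "density \<mu> (\<lambda>y. ennreal (min (p x y) (reversal_density w p x y))) = density stat (\<lambda>y. ennreal (lo x y))"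
    and density_hi:
      "density \<mu> (\<lambda>y. ennreal (max (p x y) (reversal_density w p x y))) = density stat (\<lambda>y. ennreal (hi x y))"
proof -
  note [measurable] = p_row[OF x(1)] reversal_row[OF x(1)] u_row[OF x(1)] u_column[OF x(1)]
    lo_row[OF x(1)] hi_row[OF x(1)]
  have div: "AE y in stat. reversal_density w p x y / w y = u y x"
    using AE_stat_w_pos by eventually_elim (rule reversal_density_div[OF x(2)])
  show "density \<mu> (\<lambda>y. ennreal (reversal_density w p x y)) = density stat (\<lambda>y. ennreal (u y x))"
    using div by (subst density_stat) (auto intro!: density_cong)
  have "AE y in stat. min (p x y) (reversal_density w p x y) / w y = lo x y"
    using div AE_stat_w_pos
    by eventually_elim (simp add: lo_def u_def min_divide_distrib_right)
  then show "density \<mu> (\<lambda>y. ennreal (min (p x y) (reversal_density w p x y))) = density stat (\<lambda>y. ennreal (lo x y))"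
    by (subst density_stat) (auto intro!: density_cong)
  have "AE y in stat. max (p x y) (reversal_density w p x y) / w y = hi x y"
    using div AE_stat_w_pos
    by eventually_elim (simp add: hi_def u_def max_divide_distrib_right)
  then show "density \<mu> (\<lambda>y. ennreal (max (p x y) (reversal_density w p x y))) = density stat (\<lambda>y. ennreal (hi x y))"
    by (subst density_stat) (auto intro!: density_cong)
qed

lemma
  assumes x: "x \<in> space \<mu>" "0 < w x"
  shows mass_u: "(\<integral>\<^sup>+y. ennreal (u x y) \<partial>stat) = 1"
    and mass_u_transposed: "(\<integral>\<^sup>+y. ennreal (u y x) \<partial>stat) = 1"
proof -
  note [measurable] = p_row[OF x(1)] reversal_row[OF x(1)] u_row[OF x(1)] u_column[OF x(1)]
  show "(\<integral>\<^sup>+y. ennreal (u x y) \<partial>stat) = 1"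
    using mass_out[OF x] by (simp add: nn_integral_as_mass density_forward x)
  show "(\<integral>\<^sup>+y. ennreal (u y x) \<partial>stat) = 1"
    using mass_in[OF x] by (simp add: nn_integral_as_mass density_backward x)
qed

lemma u_integrable:
  assumes x: "x \<in> space \<mu>" "0 < w x"
  shows "integrable stat (u x)" and "integrable stat (\<lambda>y. u y x)"
    and "integrable stat (lo x)" and "integrable stat (hi x)"
proof -
  note [measurable] = u_row[OF x(1)] u_column[OF x(1)]
  show 1: "integrable stat (u x)"
    by (rule integrableI_nonneg) (use x u_nonneg mass_u in \<open>auto intro!: AE_I2\<close>)
  show 2: "integrable stat (\<lambda>y. u y x)"
    by (rule integrableI_nonneg) (use x u_nonneg mass_u_transposed in \<open>auto intro!: AE_I2\<close>)
  show "integrable stat (lo x)" "integrable stat (hi x)"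
    unfolding lo_def hi_def by (intro integrable_min integrable_max 1 2)+
qed

lemma
  assumes x: "x \<in> space \<mu>" "0 < w x"
  shows mass_lo: "(\<integral>\<^sup>+y. ennreal (lo x y) \<partial>stat) = ennreal (1 - rej x)"
    and mass_hi: "(\<integral>\<^sup>+y. ennreal (hi x y) \<partial>stat) = ennreal (1 + rej x)"
    and rej_nonneg: "0 \<le> rej x"
    and rej_le_1: "rej x \<le> 1"
proof -
  note [measurable] = u_row[OF x(1)] u_column[OF x(1)]
  have U: "(LINT y|stat. u x y) = 1"
    using x u_nonneg by (subst integral_eq_nn_integral) (auto simp: mass_u)
  have U': "(LINT y|stat. u y x) = 1"
    using x u_nonneg by (subst integral_eq_nn_integral) (auto simp: mass_u_transposed)
  have lo: "(LINT y|stat. lo x y) = 1 - rej x"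
    by (simp add: rej_def)
  have "(LINT y|stat. lo x y) + (LINT y|stat. hi x y) = (LINT y|stat. lo x y + hi x y)"
    using u_integrable[OF x] by simp
  also have "\<dots> = (LINT y|stat. u x y + u y x)"
    by (rule Bochner_Integration.integral_cong) (auto simp: lo_def hi_def)
  also have "\<dots> = 2"
    using u_integrable[OF x] U U' by simp
  finally have hi: "(LINT y|stat. hi x y) = 1 + rej x"
    using lo by simp
  show "(\<integral>\<^sup>+y. ennreal (lo x y) \<partial>stat) = ennreal (1 - rej x)"
    unfolding lo[symmetric] using u_integrable[OF x] lo_nonneg x(1)
    by (intro nn_integral_eq_integral) auto
  show "(\<integral>\<^sup>+y. ennreal (hi x y) \<partial>stat) = ennreal (1 + rej x)"
    unfolding hi[symmetric] using u_integrable[OF x] hi_nonneg x(1)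
    by (intro nn_integral_eq_integral) auto
  have "(LINT y|stat. lo x y) \<le> (LINT y|stat. u x y)"
    using u_integrable[OF x] by (intro integral_mono) (auto simp: lo_def)
  then show "0 \<le> rej x" using U lo by simp
  have "0 \<le> (LINT y|stat. lo x y)"
    using lo_nonneg x(1) by (intro Bochner_Integration.integral_nonneg_AE AE_I2) auto
  then show "rej x \<le> 1" using lo by simp
qed

lemma MH_accept_mult:
  assumes "x \<in> space \<mu>" "y \<in> space \<mu>" "0 < w x"
  shows "MH_accept w p x y * p x y = min (p x y) (reversal_density w p x y)"
proof (cases "p x y = 0")
  case True
  then show ?thesis
    using assms by (simp add: MH_accept_def reversal_density_def p_nonneg w_nonneg)
next
  case False
  then have "0 < p x y" using p_nonneg[OF assms(1,2)] by simp
  then show ?thesis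
    using assms by (simp add: MH_accept_def reversal_density_def min_mult_distrib_right min.commute)
qed

text \<open>
  On the diagonal the time-reversed density coincides with \<open>p\<close> and the integrand
  \<open>p x y - min (p x y) (reversal_density w p x y)\<close> vanishes. Removing the point \<open>x\<close> from the domain
  therefore changes nothing, even if \<open>{x}\<close> is not measurable or carries positive mass.
\<close>

lemma MH_reject_eq:
  assumes x: "x \<in> space \<mu>" "0 < w x"
  shows "MH_reject \<mu> w p x = rej x"
proof -
  note [measurable] = p_row[OF x(1)] reversal_row[OF x(1)] lo_row[OF x(1)]
  have eq: "indicator {y \<in> space \<mu>. y \<noteq> x} y *\<^sub>R ((1 - MH_accept w p x y) * p x y)
      = p x y - min (p x y) (reversal_density w p x y)" if y: "y \<in> space \<mu>" for y
  proof (cases "y = x")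
    case True
    then show ?thesis using x by (simp add: reversal_density_def)
  next
    case False
    then show ?thesis using MH_accept_mult[OF x(1) y x(2)] y by (simp add: left_diff_distrib)
  qed
  have p_int: "integrable \<mu> (p x)"
    by (rule integrableI_nonneg) (use x p_nonneg mass_out in \<open>auto intro!: AE_I2\<close>)
  have r_int: "integrable \<mu> (reversal_density w p x)"
    by (rule integrableI_nonneg)
       (use x p_nonneg w_nonneg mass_in in \<open>auto intro!: AE_I2 simp: reversal_density_def\<close>)
  have m_int: "integrable \<mu> (\<lambda>y. min (p x y) (reversal_density w p x y))"
    by (intro integrable_min p_int r_int)
  have m_nonneg: "0 \<le> min (p x y) (reversal_density w p x y)" if "y \<in> space \<mu>" for y
    using x that by (simp add: reversal_density_def p_nonneg w_nonneg)
  have "ennreal (LINT y|\<mu>. min (p x y) (reversal_density w p x y))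
      = (\<integral>\<^sup>+y. ennreal (min (p x y) (reversal_density w p x y)) \<partial>\<mu>)"
    using m_int m_nonneg by (intro nn_integral_eq_integral[symmetric]) auto
  also have "\<dots> = (\<integral>\<^sup>+y. ennreal (lo x y) \<partial>stat)"
    by (simp add: nn_integral_as_mass density_lo x)
  finally have "(LINT y|\<mu>. min (p x y) (reversal_density w p x y)) = 1 - rej x"
    using rej_le_1[OF x] m_nonneg by (simp add: mass_lo x Bochner_Integration.integral_nonneg)
  moreover have "(LINT y|\<mu>. p x y) = 1"
    using x p_nonneg by (subst integral_eq_nn_integral) (auto simp: mass_out)
  ultimately have diff: "(LINT y|\<mu>. p x y - min (p x y) (reversal_density w p x y)) = rej x"
    using p_int m_int by simp
  show ?thesis
    unfolding MH_reject_def set_lebesgue_integral_def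
    by (rule trans[OF Bochner_Integration.integral_cong[OF refl eq] diff])
qed

section \<open>The Metropolis-Hastings kernels relative to the stationary measure\<close>

lemma MH1_eq:
  assumes "x \<in> space \<mu>" "0 < w x"
  shows "MH1 \<mu> w p x = signed_of (\<lambda>x. add_measure (density stat (\<lambda>y. ennreal (lo x y)))
           (scale_measure (ennreal (rej x)) (return \<mu> x))) x"
  using assms by (simp add: MH1_def signed_of_def density_lo MH_reject_eq)

lemma MH2_eq:
  assumes "x \<in> space \<mu>" "0 < w x"
  shows "MH2 \<mu> w p x = (density stat (\<lambda>y. ennreal (hi x y)), scale_measure (ennreal (rej x)) (return \<mu> x))"
  using assms by (simp add: MH2_def density_hi MH_reject_eq)

lemma u_swap_measurable: "(\<lambda>(x, y). u y x) \<in> borel_measurable (stat \<Otimes>\<^sub>M stat)"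
  using measurable_pair_swap[OF u_measurable] by simp

sublocale lo: symmetric_kernel stat lo 1
proof
  show "(\<lambda>(x, y). lo x y) \<in> borel_measurable (stat \<Otimes>\<^sub>M stat)"
    using borel_measurable_min[OF u_measurable u_swap_measurable]
    by (simp add: lo_def case_prod_beta')
  show "AE x in stat. (\<integral>\<^sup>+y. ennreal (lo x y) \<partial>stat) \<le> ennreal 1"
    using AE_stat_pos by eventually_elim (simp add: mass_lo rej_nonneg)
qed (auto simp: u_nonneg lo_def min.commute)

sublocale hi: symmetric_kernel stat hi 2
proof
  show "(\<lambda>(x, y). hi x y) \<in> borel_measurable (stat \<Otimes>\<^sub>M stat)"
    using borel_measurable_max[OF u_measurable u_swap_measurable]
    by (simp add: hi_def case_prod_beta')
  show "AE x in stat. (\<integral>\<^sup>+y. ennreal (hi x y) \<partial>stat) \<le> ennreal 2"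
    using AE_stat_pos
  proof eventually_elim
    case (elim x)
    then show ?case
      using rej_le_1[of x] by (simp only: mass_hi) (rule ennreal_leI, simp)
  qed
qed (auto simp: u_nonneg hi_def max.commute le_max_iff_disj)

lemma rej_measurable [measurable]: "rej \<in> borel_measurable stat"
  unfolding rej_def using lo.h_measurable by measurable

lemma AE_rej_bound: "AE x in stat. \<bar>rej x\<bar> \<le> 1"
  using AE_stat_pos by eventually_elim (use rej_nonneg rej_le_1 in auto)

lemma integral_density_stat:
  fixes f :: "'a \<Rightarrow> complex"
  assumes k: "k \<in> borel_measurable stat" "\<And>y. y \<in> space \<mu> \<Longrightarrow> 0 \<le> k y" and f: "f \<in> borel_measurable stat"
  shows "integrable (density stat (\<lambda>y. ennreal (k y))) f \<longleftrightarrow> integrable stat (\<lambda>y. k y *\<^sub>R f y)"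
    and "(LINT y|density stat (\<lambda>y. ennreal (k y)). f y) = (LINT y|stat. k y *\<^sub>R f y)"
  by (rule integrable_density integral_density; use assms in auto)+

text \<open>
  Both densities lie below \<open>hi\<close>, whose rows are integrable by the Schur estimate.
\<close>

lemma u_row_integrable:
  assumes f: "f \<in> L2 stat"
  shows "AE x in stat. integrable stat (\<lambda>y. u x y *\<^sub>R f y) \<and> integrable stat (\<lambda>y. u y x *\<^sub>R f y)"
  using hi.row_integrable[OF f] AE_stat_pos
proof eventually_elim
  case (elim x)
  have [measurable]: "f \<in> borel_measurable stat" using f by auto
  note [measurable] = u_row[OF conjunct1[OF elim(2)]] u_column[OF conjunct1[OF elim(2)]]
  show ?case
    using elim(2) u_nonneg
    by (intro conjI Bochner_Integration.integrable_bound[OF elim(1)] AE_I2) (auto simp: hi_def intro!: mult_right_mono)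
qed

lemma induces_MH1:
  "kernel_induces stat (MH1 \<mu> w p) (\<lambda>f x. lo.int_op f x + rej x *\<^sub>R f x)"
  unfolding kernel_induces_def
proof
  fix f assume f: "f \<in> L2 stat"
  then have fm [measurable]: "f \<in> borel_measurable stat" by auto
  show "AE x in stat. kernel_integrable (MH1 \<mu> w p) f x \<and>
      lo.int_op f x + rej x *\<^sub>R f x = kernel_act (MH1 \<mu> w p) f x"
    using lo.row_integrable[OF f] AE_stat_pos
  proof eventually_elim
    case (elim x)
    then have x: "x \<in> space \<mu>" "0 < w x" by auto
    have fm': "f \<in> borel_measurable \<mu>" using fm by (simp cong: measurable_cong_sets)
    show ?case
      using elim(1) scale_measure_return_integral[OF x(1) fm' rej_nonneg[OF x]]
        integral_density_stat[OF lo_row[OF x(1)] lo_nonneg[OF x(1)] fm]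
      by (simp add: kernel_integrable_def kernel_act_def MH1_eq[OF x] signed_of_def lo.int_op_def
          integrable_add_measure_iff integral_add_measure)
  qed
qed

lemma induces_MH2:
  "kernel_induces stat (MH2 \<mu> w p) (\<lambda>f x. hi.int_op f x + (- rej x) *\<^sub>R f x)"
  unfolding kernel_induces_def
proof
  fix f assume f: "f \<in> L2 stat"
  then have fm [measurable]: "f \<in> borel_measurable stat" by auto
  show "AE x in stat. kernel_integrable (MH2 \<mu> w p) f x \<and>
      hi.int_op f x + (- rej x) *\<^sub>R f x = kernel_act (MH2 \<mu> w p) f x"
    using hi.row_integrable[OF f] AE_stat_pos
  proof eventually_elim
    case (elim x)
    then have x: "x \<in> space \<mu>" "0 < w x" by auto
    have fm': "f \<in> borel_measurable \<mu>" using fm by (simp cong: measurable_cong_sets)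
    show ?case
      using elim(1) scale_measure_return_integral[OF x(1) fm' rej_nonneg[OF x]]
        integral_density_stat[OF hi_row[OF x(1)] hi_nonneg[OF x(1)] fm]
      by (simp add: kernel_integrable_def kernel_act_def MH2_eq[OF x] hi.int_op_def)
  qed
qed

lemma induces_forward:
  assumes K: "\<forall>x\<in>space \<mu>. 0 < w x \<longrightarrow> K x = density \<mu> (\<lambda>y. ennreal (p x y))"
  shows "kernel_induces stat (signed_of K) (\<lambda>f x. LINT y|stat. u x y *\<^sub>R f y)"
  unfolding kernel_induces_def
proof
  fix f assume f: "f \<in> L2 stat"
  then have fm [measurable]: "f \<in> borel_measurable stat" by auto
  show "AE x in stat. kernel_integrable (signed_of K) f x \<and>
      (LINT y|stat. u x y *\<^sub>R f y) = kernel_act (signed_of K) f x"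
    using u_row_integrable[OF f] AE_stat_pos
  proof eventually_elim
    case (elim x)
    then have x: "x \<in> space \<mu>" "0 < w x" by auto
    show ?case
      using elim(1) integral_density_stat[OF u_row[OF x(1)] u_nonneg[OF x(1)] fm]
      by (simp add: kernel_integrable_def kernel_act_def signed_of_def K[rule_format, OF x] density_forward[OF x(1)])
  qed
qed

lemma induces_backward:
  assumes K: "\<forall>x\<in>space \<mu>. 0 < w x \<longrightarrow> K x = density \<mu> (\<lambda>y. ennreal (reversal_density w p x y))"
  shows "kernel_induces stat (signed_of K) (\<lambda>f x. LINT y|stat. u y x *\<^sub>R f y)"
  unfolding kernel_induces_def
proof
  fix f assume f: "f \<in> L2 stat"
  then have fm [measurable]: "f \<in> borel_measurable stat" by auto
  show "AE x in stat. kernel_integrable (signed_of K) f x \<and>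
      (LINT y|stat. u y x *\<^sub>R f y) = kernel_act (signed_of K) f x"
    using u_row_integrable[OF f] AE_stat_pos
  proof eventually_elim
    case (elim x)
    then have x: "x \<in> space \<mu>" "0 < w x" by auto
    show ?case
      using elim(1) integral_density_stat[OF u_column[OF x(1)] u_nonneg[OF _ x(1)] fm]
      by (simp add: kernel_integrable_def kernel_act_def signed_of_def K[rule_format, OF x] density_backward[OF x])
  qed
qed

text \<open>
  The Dirac parts cancel, and \<open>u x y + u y x = lo x y + hi x y\<close>.
\<close>

lemma MH_sum:
  assumes P: "\<forall>x\<in>space \<mu>. 0 < w x \<longrightarrow> P x = density \<mu> (\<lambda>y. ennreal (p x y))"
    and Q: "\<forall>x\<in>space \<mu>. 0 < w x \<longrightarrow> Q x = density \<mu> (\<lambda>y. ennreal (reversal_density w p x y))"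
  shows "kernel_eq stat (kernel_add (signed_of P) (signed_of Q)) (kernel_add (MH1 \<mu> w p) (MH2 \<mu> w p))"
proof -
  have "kernel_induces stat (kernel_add (signed_of P) (signed_of Q))
      (\<lambda>f x. (LINT y|stat. u x y *\<^sub>R f y) + (LINT y|stat. u y x *\<^sub>R f y))"
  proof (intro kernel_induces_add induces_forward induces_backward P Q)
    show "AE x in stat. sets (fst (signed_of P x)) = sets (fst (signed_of Q x)) \<and>
        sets (snd (signed_of P x)) = sets (snd (signed_of Q x))"
      using AE_stat_pos by eventually_elim (simp add: signed_of_def P Q)
  qed
  moreover have "kernel_induces stat (kernel_add (MH1 \<mu> w p) (MH2 \<mu> w p))
      (\<lambda>f x. (lo.int_op f x + rej x *\<^sub>R f x) + (hi.int_op f x + (- rej x) *\<^sub>R f x))"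
  proof (intro kernel_induces_add induces_MH1 induces_MH2)
    show "AE x in stat. sets (fst (MH1 \<mu> w p x)) = sets (fst (MH2 \<mu> w p x)) \<and>
        sets (snd (MH1 \<mu> w p x)) = sets (snd (MH2 \<mu> w p x))"
      using AE_stat_pos by eventually_elim (simp add: signed_of_def MH1_eq MH2_eq)
  qed
  moreover have "AE x in stat. (LINT y|stat. u x y *\<^sub>R f y) + (LINT y|stat. u y x *\<^sub>R f y)
      = (lo.int_op f x + rej x *\<^sub>R f x) + (hi.int_op f x + (- rej x) *\<^sub>R f x)" if f: "f \<in> L2 stat" for f
    using u_row_integrable[OF f] lo.row_integrable[OF f] hi.row_integrable[OF f]
  proof eventually_elim
    case (elim x)
    have "(LINT y|stat. u x y *\<^sub>R f y) + (LINT y|stat. u y x *\<^sub>R f y)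
        = (LINT y|stat. u x y *\<^sub>R f y + u y x *\<^sub>R f y)"
      using elim by simp
    also have "\<dots> = (LINT y|stat. lo x y *\<^sub>R f y + hi x y *\<^sub>R f y)"
      by (rule Bochner_Integration.integral_cong) (auto simp: lo_def hi_def min_def max_def)
    also have "\<dots> = lo.int_op f x + hi.int_op f x"
      using elim by (simp add: lo.int_op_def hi.int_op_def)
    finally show ?case by simp
  qed
  ultimately show ?thesis
    by (simp add: kernel_eq_iff_induced)
qed

text \<open>
  The mass \<open>1 + r(x)\<close> of \<open>hi x\<close> exceeds one by exactly the weight of the Dirac part.
\<close>

lemma MH2_mass:
  assumes x: "x \<in> space \<mu>" "0 < w x"
  shows "kernel_mass (MH2 \<mu> w p) x (space \<mu>) = 1"
proof -
  have "measure (density stat (\<lambda>y. ennreal (hi x y))) (space \<mu>) = 1 + rej x"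
    using mass_hi[OF x] rej_nonneg[OF x] hi_row[OF x(1)]
    by (simp add: measure_def nn_integral_as_mass)
  moreover have "measure (return \<mu> x) (space \<mu>) = 1"
    using x by (simp add: measure_return)
  ultimately show ?thesis
    by (simp add: kernel_mass_def MH2_eq[OF x] rej_nonneg[OF x])
qed

lemma MH1_self_adjoint: "kernel_self_adjoint stat (MH1 \<mu> w p)"
  unfolding kernel_self_adjoint_def
  using induces_MH1 L2_self_adjoint_add[OF lo.int_op_self_adjoint
      L2_self_adjoint_multiplication[OF rej_measurable AE_rej_bound]] by blast

lemma MH2_self_adjoint: "kernel_self_adjoint stat (MH2 \<mu> w p)"
proof -
  have "L2_self_adjoint stat (\<lambda>f x. (- rej x) *\<^sub>R f x)"
    using AE_rej_bound by (intro L2_self_adjoint_multiplication[of _ _ 1]) auto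
  then show ?thesis
    unfolding kernel_self_adjoint_def
    using induces_MH2 L2_self_adjoint_add[OF hi.int_op_self_adjoint] by blast
qed

section \<open>Reversibility\<close>

lemma forward_flow:
  assumes P: "\<forall>x\<in>space \<mu>. 0 < w x \<longrightarrow> P x = density \<mu> (\<lambda>y. ennreal (p x y))"
    and B: "B \<in> sets \<mu>"
  shows "(\<integral>\<^sup>+x\<in>A. emeasure (P x) B \<partial>stat)
    = (\<integral>\<^sup>+x. (\<integral>\<^sup>+y. ennreal (u x y) * indicator B y \<partial>stat) * indicator A x \<partial>stat)"
proof (rule nn_integral_cong_AE, use AE_stat_pos in eventually_elim)
  case (elim x)
  then show ?case
    using B by (simp add: P density_forward emeasure_density u_row)
qed

text \<open>
  The right-hand side is the flow from \<open>A\<close> to \<open>B\<close> of the time-reversal, so the flow of the chain from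
  \<open>B\<close> to \<open>A\<close> is compared with it over the same rectangle \<open>A \<times> B\<close>.
\<close>

lemma flow_transposed:
  assumes [measurable]: "A \<in> sets \<mu>" "B \<in> sets \<mu>"
  shows "(\<integral>\<^sup>+y. (\<integral>\<^sup>+x. ennreal (u y x) * indicator A x \<partial>stat) * indicator B y \<partial>stat)
    = (\<integral>\<^sup>+x. (\<integral>\<^sup>+y. ennreal (u y x) * indicator B y \<partial>stat) * indicator A x \<partial>stat)"
proof -
  have "(\<integral>\<^sup>+y. (\<integral>\<^sup>+x. ennreal (u y x) * indicator A x \<partial>stat) * indicator B y \<partial>stat)
    = (\<integral>\<^sup>+y. (\<integral>\<^sup>+x. ennreal (u y x) * indicator A x * indicator B y \<partial>stat) \<partial>stat)"
    by (intro nn_integral_cong) (simp add: nn_integral_multc u_row)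
  also have "\<dots> = (\<integral>\<^sup>+x. (\<integral>\<^sup>+y. ennreal (u y x) * indicator A x * indicator B y \<partial>stat) \<partial>stat)"
    using u_measurable by (intro lo.pair.Fubini'[symmetric]) measurable
  also have "\<dots> = (\<integral>\<^sup>+x. (\<integral>\<^sup>+y. ennreal (u y x) * indicator B y \<partial>stat) * indicator A x \<partial>stat)"
    by (intro nn_integral_cong) (simp split: split_indicator)
  finally show ?thesis .
qed

text \<open>
  Reversibility says that \<open>u\<close> and its transpose, as densities on the product space, define measures
  that agree on rectangles. The first one gives \<open>F \<times> space\<close> the mass \<open>\<pi>(F)\<close>, so rectangles over a
  \<open>\<sigma>\<close>-finite exhaustion determine both measures, and densities are unique almost everywhere.
\<close>

lemma reversible_imp_symmetric:
  assumes P: "\<forall>x\<in>space \<mu>. 0 < w x \<longrightarrow> P x = density \<mu> (\<lambda>y. ennreal (p x y))"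
    and rev: "reversible stat P"
  shows "AE x in stat. AE y in stat. u x y = u y x"
proof -
  let ?N = "stat \<Otimes>\<^sub>M stat"
  note [measurable] = u_measurable u_swap_measurable
  obtain F :: "nat \<Rightarrow> 'a set" where F: "range F \<subseteq> sets stat" "(\<Union>i. F i) = space stat"
      "\<And>i. emeasure stat (F i) \<noteq> \<infinity>"
    using stat.sigma_finite by metis
  let ?D = "density ?N (\<lambda>z. ennreal (case z of (x, y) \<Rightarrow> u x y))"
  let ?E = "density ?N (\<lambda>z. ennreal (case z of (x, y) \<Rightarrow> u y x))"
  have rect: "emeasure (density ?N (\<lambda>z. ennreal (case z of (x, y) \<Rightarrow> k x y))) (A \<times> B)
      = (\<integral>\<^sup>+x. (\<integral>\<^sup>+y. ennreal (k x y) * indicator B y \<partial>stat) * indicator A x \<partial>stat)"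
    if k [measurable]: "(\<lambda>(x, y). k x y) \<in> borel_measurable ?N"
      and [measurable]: "A \<in> sets stat" "B \<in> sets stat" for k A B
  proof -
    have row: "k x \<in> borel_measurable stat" if "x \<in> space stat" for x
      using measurable_compose[OF measurable_Pair1'[OF that] k] by simp
    have "emeasure (density ?N (\<lambda>z. ennreal (case z of (x, y) \<Rightarrow> k x y))) (A \<times> B)
        = (\<integral>\<^sup>+z. ennreal (case z of (x, y) \<Rightarrow> k x y) * indicator (A \<times> B) z \<partial>?N)"
      by (rule emeasure_density) measurable
    also have "\<dots> = (\<integral>\<^sup>+x. (\<integral>\<^sup>+y. ennreal (k x y) * indicator (A \<times> B) (x, y) \<partial>stat) \<partial>stat)"
      by (subst stat.nn_integral_fst[symmetric]) simp_all
    also have "\<dots> = (\<integral>\<^sup>+x. (\<integral>\<^sup>+y. ennreal (k x y) * indicator B y \<partial>stat) * indicator A x \<partial>stat)"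
      by (intro nn_integral_cong)
         (simp add: indicator_times row split: split_indicator)
    finally show ?thesis .
  qed
  have "?D = ?E"
  proof (rule measure_eqI_generator_eq[OF Int_stable_pair_measure_generator[of stat stat]])
    show "{a \<times> b |a b. a \<in> sets stat \<and> b \<in> sets stat} \<subseteq> Pow (space stat \<times> space stat)"
      using sets.space_closed[of stat] by auto
    show "sets ?D = sigma_sets (space stat \<times> space stat) {a \<times> b |a b. a \<in> sets stat \<and> b \<in> sets stat}"
      "sets ?E = sigma_sets (space stat \<times> space stat) {a \<times> b |a b. a \<in> sets stat \<and> b \<in> sets stat}"
      by (simp_all add: sets_pair_measure)
    show "range (\<lambda>i. F i \<times> space stat) \<subseteq> {a \<times> b |a b. a \<in> sets stat \<and> b \<in> sets stat}"
      using F(1) by blast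
    show "(\<Union>i. F i \<times> space stat) = space stat \<times> space stat"
      using F(2) by blast
    show "emeasure ?D X = emeasure ?E X"
      if "X \<in> {a \<times> b |a b. a \<in> sets stat \<and> b \<in> sets stat}" for X
    proof -
      from that obtain A B where X: "X = A \<times> B" and AB: "A \<in> sets stat" "B \<in> sets stat" by blast
      have "(\<integral>\<^sup>+x\<in>A. emeasure (P x) B \<partial>stat) = (\<integral>\<^sup>+y\<in>B. emeasure (P y) A \<partial>stat)"
        using rev AB unfolding reversible_def time_reversal_def by blast
      then show ?thesis
        using AB by (simp add: X rect forward_flow[OF P] flow_transposed)
    qed
    show "emeasure ?D (F i \<times> space stat) \<noteq> \<infinity>" for i
    proof -
      have Fi: "F i \<in> sets stat" using F(1) by auto
      have "emeasure ?D (F i \<times> space stat)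
          = (\<integral>\<^sup>+x. (\<integral>\<^sup>+y. ennreal (u x y) * indicator (space stat) y \<partial>stat) * indicator (F i) x \<partial>stat)"
        using Fi by (intro rect) auto
      also have "\<dots> = (\<integral>\<^sup>+x. indicator (F i) x \<partial>stat)"
      proof (rule nn_integral_cong_AE, use AE_stat_pos in eventually_elim)
        case (elim x)
        have "(\<integral>\<^sup>+y. ennreal (u x y) * indicator (space stat) y \<partial>stat) = (\<integral>\<^sup>+y. ennreal (u x y) \<partial>stat)"
          by (intro nn_integral_cong) simp
        with elim show ?case by (simp add: mass_u)
      qed
      finally show ?thesis
        using F(3) Fi by simp
    qed
  qed
  then have "AE z in ?N. ennreal (case z of (x, y) \<Rightarrow> u x y) = ennreal (case z of (x, y) \<Rightarrow> u y x)"
    by (subst (asm) lo.pair.density_unique_iff) measurable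
  then have "AE z in ?N. (case z of (x, y) \<Rightarrow> u x y) = (case z of (x, y) \<Rightarrow> u y x)"
    using AE_space by eventually_elim (auto simp: space_pair_measure u_nonneg)
  then show ?thesis
    by (auto dest: lo.pair.AE_pair)
qed

text \<open>
  Where \<open>u\<close> agrees with its transpose, \<open>lo x\<close> already has mass one, so nothing is left for the Dirac
  part.
\<close>

lemma symmetric_imp_MH_eq:
  assumes P: "\<forall>x\<in>space \<mu>. 0 < w x \<longrightarrow> P x = density \<mu> (\<lambda>y. ennreal (p x y))"
    and sym: "AE x in stat. AE y in stat. u x y = u y x"
  shows "kernel_eq stat (MH1 \<mu> w p) (signed_of P)" and "kernel_eq stat (MH2 \<mu> w p) (signed_of P)"
proof -
  have ae: "AE x in stat. (AE y in stat. lo x y = u x y \<and> hi x y = u x y) \<and> rej x = 0"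
    using sym AE_stat_pos
  proof eventually_elim
    case (elim x)
    then have x: "x \<in> space \<mu>" "0 < w x" by auto
    have eq: "AE y in stat. lo x y = u x y \<and> hi x y = u x y"
      using elim(1) by eventually_elim (simp add: lo_def hi_def)
    then have "(\<integral>\<^sup>+y. ennreal (lo x y) \<partial>stat) = (\<integral>\<^sup>+y. ennreal (u x y) \<partial>stat)"
      by (intro nn_integral_cong_AE) (auto elim!: eventually_mono)
    then have "ennreal (1 - rej x) = 1"
      by (simp add: mass_lo[OF x] mass_u[OF x])
    then have "rej x = 0" by simp
    with eq show ?case by blast
  qed
  have "AE x in stat. lo.int_op f x + rej x *\<^sub>R f x = (LINT y|stat. u x y *\<^sub>R f y) \<and>
      hi.int_op f x + (- rej x) *\<^sub>R f x = (LINT y|stat. u x y *\<^sub>R f y)" if f: "f \<in> L2 stat" for f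
    using ae AE_stat_pos
  proof eventually_elim
    case (elim x)
    have [measurable]: "f \<in> borel_measurable stat" using f by auto
    have x: "x \<in> space \<mu>" using elim by simp
    note [measurable] = u_row[OF x] lo_row[OF x] hi_row[OF x]
    have "AE y in stat. lo x y *\<^sub>R f y = u x y *\<^sub>R f y" "AE y in stat. hi x y *\<^sub>R f y = u x y *\<^sub>R f y"
      by (rule eventually_mono[OF conjunct1[OF elim(1)]], simp)+
    then have "lo.int_op f x = (LINT y|stat. u x y *\<^sub>R f y)" "hi.int_op f x = (LINT y|stat. u x y *\<^sub>R f y)"
      unfolding lo.int_op_def hi.int_op_def by (auto intro!: integral_cong_AE)
    with elim(1) show ?case by simp
  qed
  then show "kernel_eq stat (MH1 \<mu> w p) (signed_of P)" "kernel_eq stat (MH2 \<mu> w p) (signed_of P)"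
    unfolding kernel_eq_iff_induced[OF induces_MH1 induces_forward[OF P]]
      kernel_eq_iff_induced[OF induces_MH2 induces_forward[OF P]]
    by (auto elim!: eventually_mono)
qed

text \<open>
  Equality as operators speaks about functions in \<open>L\<^sup>2\<close> only. Indicators of sets of finite measure
  belong to this space; an arbitrary \<open>B\<close> is cut into countably many pieces of finite measure, and
  the countably many exceptional null sets are harmless.
\<close>

lemma MH1_eq_imp_mass:
  assumes P: "\<forall>x\<in>space \<mu>. 0 < w x \<longrightarrow> P x = density \<mu> (\<lambda>y. ennreal (p x y))"
    and eq: "kernel_eq stat (MH1 \<mu> w p) (signed_of P)" and B: "B \<in> sets \<mu>"
  shows "AE x in stat. (\<integral>\<^sup>+y. ennreal (u x y) * indicator B y \<partial>stat)
    = (\<integral>\<^sup>+y. ennreal (lo x y) * indicator B y \<partial>stat) + ennreal (rej x) * indicator B x"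
proof -
  have fin: "AE x in stat. (\<integral>\<^sup>+y. ennreal (u x y) * indicator B y \<partial>stat)
    = (\<integral>\<^sup>+y. ennreal (lo x y) * indicator B y \<partial>stat) + ennreal (rej x) * indicator B x"
    if B: "B \<in> sets \<mu>" and Bfin: "emeasure stat B \<noteq> \<infinity>" for B
  proof -
    have sq: "ennreal ((cmod (indicator B x))\<^sup>2) = indicator B x" for x
      by (simp split: split_indicator)
    have "(indicator B :: 'a \<Rightarrow> complex) \<in> L2 stat"
      using B Bfin by (simp add: L2_iff_nn_integral sq top.not_eq_extremum)
    with eq have "AE x in stat. lo.int_op (indicator B) x + rej x *\<^sub>R (indicator B x :: complex)
        = (LINT y|stat. u x y *\<^sub>R indicator B y)"
      unfolding kernel_eq_iff_induced[OF induces_MH1 induces_forward[OF P]] by blast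
    then show ?thesis
      using AE_stat_pos
    proof eventually_elim
      case (elim x)
      then have x: "x \<in> space \<mu>" "0 < w x" by auto
      have cplx: "(LINT y|stat. k y *\<^sub>R (indicator B y :: complex))
          = complex_of_real (LINT y|stat. k y * indicator B y)" for k
        by (subst integral_complex_of_real[symmetric])
           (intro Bochner_Integration.integral_cong refl, simp add: indicator_def scaleR_conv_of_real)
      have ind: "(indicator B x :: complex) = complex_of_real (indicator B x)"
        by (simp add: indicator_def)
      have "complex_of_real ((LINT y|stat. lo x y * indicator B y) + rej x * indicator B x)
          = complex_of_real (LINT y|stat. u x y * indicator B y)"
        using elim(1) unfolding lo.int_op_def cplx ind by (simp add: scaleR_conv_of_real)
      then have real: "(LINT y|stat. lo x y * indicator B y) + rej x * indicator B x
          = (LINT y|stat. u x y * indicator B y)"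
        by (simp only: of_real_eq_iff)
      have nn: "(\<integral>\<^sup>+y. ennreal (k y) * indicator B y \<partial>stat) = ennreal (LINT y|stat. k y * indicator B y)"
        and pos: "0 \<le> (LINT y|stat. k y * indicator B y)"
        if k: "integrable stat k" "\<And>y. y \<in> space \<mu> \<Longrightarrow> 0 \<le> k y" for k
      proof -
        have "(\<integral>\<^sup>+y. ennreal (k y) * indicator B y \<partial>stat) = (\<integral>\<^sup>+y. ennreal (k y * indicator B y) \<partial>stat)"
          by (intro nn_integral_cong) (simp add: indicator_def)
        also have "\<dots> = ennreal (LINT y|stat. k y * indicator B y)"
          using k B by (intro nn_integral_eq_integral integrable_real_mult_indicator AE_I2) auto
        finally show "(\<integral>\<^sup>+y. ennreal (k y) * indicator B y \<partial>stat) = ennreal (LINT y|stat. k y * indicator B y)" .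
        show "0 \<le> (LINT y|stat. k y * indicator B y)"
          using k by (intro Bochner_Integration.integral_nonneg) auto
      qed
      have "(\<integral>\<^sup>+y. ennreal (u x y) * indicator B y \<partial>stat)
          = ennreal ((LINT y|stat. lo x y * indicator B y) + rej x * indicator B x)"
        using real nn[OF u_integrable(1)[OF x]] u_nonneg[OF x(1)] by simp
      also have "\<dots> = ennreal (LINT y|stat. lo x y * indicator B y) + ennreal (rej x * indicator B x)"
        using pos[OF u_integrable(3)[OF x]] lo_nonneg[OF x(1)] rej_nonneg[OF x]
        by (intro ennreal_plus) auto
      also have "\<dots> = (\<integral>\<^sup>+y. ennreal (lo x y) * indicator B y \<partial>stat) + ennreal (rej x) * indicator B x"
        using nn[OF u_integrable(3)[OF x]] lo_nonneg[OF x(1)] by (simp add: indicator_def)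
      finally show ?case .
    qed
  qed
  obtain F :: "nat \<Rightarrow> 'a set" where F: "range F \<subseteq> sets stat" "(\<Union>i. F i) = space stat"
      "\<And>i. emeasure stat (F i) \<noteq> \<infinity>" "disjoint_family F"
    using stat.sigma_finite_disjoint by metis
  have Fs: "F i \<in> sets \<mu>" for i using F(1) by auto
  have "AE x in stat. \<forall>i. (\<integral>\<^sup>+y. ennreal (u x y) * indicator (B \<inter> F i) y \<partial>stat)
    = (\<integral>\<^sup>+y. ennreal (lo x y) * indicator (B \<inter> F i) y \<partial>stat) + ennreal (rej x) * indicator (B \<inter> F i) x"
  proof (subst AE_all_countable, intro allI fin)
    fix i
    show "B \<inter> F i \<in> sets \<mu>" using B Fs by auto
    have "emeasure stat (B \<inter> F i) \<le> emeasure stat (F i)"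
      using Fs by (intro emeasure_mono) auto
    then show "emeasure stat (B \<inter> F i) \<noteq> \<infinity>"
      using F(3)[of i] by (auto simp: top_unique)
  qed
  then show ?thesis
    using AE_stat_pos
  proof eventually_elim
    case (elim x)
    then have x: "x \<in> space \<mu>" "0 < w x" by auto
    have split: "indicator B y = (\<Sum>i. indicator (B \<inter> F i) y :: ennreal)" if "y \<in> space \<mu>" for y
    proof -
      have "(\<Union>i. B \<inter> F i) = B"
        using F(2) sets.sets_into_space[OF B] by auto
      moreover have "disjoint_family (\<lambda>i. B \<inter> F i)"
        using F(4) by (auto simp: disjoint_family_on_def)
      ultimately show ?thesis
        using suminf_indicator[of "\<lambda>i. B \<inter> F i" y] by simp
    qed
    have sums: "(\<integral>\<^sup>+y. ennreal (k y) * indicator B y \<partial>stat)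
        = (\<Sum>i. \<integral>\<^sup>+y. ennreal (k y) * indicator (B \<inter> F i) y \<partial>stat)"
      if [measurable]: "k \<in> borel_measurable stat" for k
    proof -
      have "(\<integral>\<^sup>+y. ennreal (k y) * indicator B y \<partial>stat)
          = (\<integral>\<^sup>+y. (\<Sum>i. ennreal (k y) * indicator (B \<inter> F i) y) \<partial>stat)"
        by (intro nn_integral_cong) (simp add: split ennreal_suminf_cmult)
      also have "\<dots> = (\<Sum>i. \<integral>\<^sup>+y. ennreal (k y) * indicator (B \<inter> F i) y \<partial>stat)"
        using B Fs by (intro nn_integral_suminf) auto
      finally show ?thesis .
    qed
    show ?case
      unfolding sums[OF u_row[OF x(1)]] sums[OF lo_row[OF x(1)]] split[OF x(1)]
      using elim(1) by (simp add: suminf_add[symmetric] ennreal_suminf_cmult)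
  qed
qed

text \<open>
  The flow of \<open>M\<^sub>1\<close> from \<open>A\<close> to \<open>B\<close> consists of the integral of the symmetric function \<open>lo\<close> over
  \<open>A \<times> B\<close> and of a Dirac part living on \<open>A \<inter> B\<close>; both are symmetric in \<open>A\<close> and \<open>B\<close>.
\<close>

lemma MH1_eq_imp_reversible:
  assumes P: "\<forall>x\<in>space \<mu>. 0 < w x \<longrightarrow> P x = density \<mu> (\<lambda>y. ennreal (p x y))"
    and eq: "kernel_eq stat (MH1 \<mu> w p) (signed_of P)"
  shows "reversible stat P"
  unfolding reversible_def time_reversal_def
proof (intro ballI)
  fix A B assume "A \<in> sets stat" "B \<in> sets stat"
  then have [measurable]: "A \<in> sets \<mu>" "B \<in> sets \<mu>" by auto
  have flow: "(\<integral>\<^sup>+x\<in>A. emeasure (P x) B \<partial>stat)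
      = (\<integral>\<^sup>+x. (\<integral>\<^sup>+y. ennreal (lo x y) * indicator B y * indicator A x \<partial>stat) \<partial>stat)
        + (\<integral>\<^sup>+x. ennreal (rej x) * indicator (A \<inter> B) x \<partial>stat)"
    if [measurable]: "A \<in> sets \<mu>" "B \<in> sets \<mu>" for A B
  proof -
    note lo.h_measurable [measurable]
    have "(\<integral>\<^sup>+x\<in>A. emeasure (P x) B \<partial>stat)
        = (\<integral>\<^sup>+x. (\<integral>\<^sup>+y. ennreal (lo x y) * indicator B y * indicator A x \<partial>stat)
             + ennreal (rej x) * indicator (A \<inter> B) x \<partial>stat)"
      unfolding forward_flow[OF P that(2)]
    proof (rule nn_integral_cong_AE, use MH1_eq_imp_mass[OF P eq that(2)] AE_stat_pos in eventually_elim)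
      case (elim x)
      then show ?case
        by (auto simp: indicator_def nn_integral_multc lo_row distrib_right)
    qed
    also have "\<dots> = (\<integral>\<^sup>+x. (\<integral>\<^sup>+y. ennreal (lo x y) * indicator B y * indicator A x \<partial>stat) \<partial>stat)
        + (\<integral>\<^sup>+x. ennreal (rej x) * indicator (A \<inter> B) x \<partial>stat)"
      by (rule nn_integral_add) measurable
    finally show ?thesis .
  qed
  note lo.h_measurable [measurable]
  have "(\<integral>\<^sup>+x. (\<integral>\<^sup>+y. ennreal (lo x y) * indicator B y * indicator A x \<partial>stat) \<partial>stat)
      = (\<integral>\<^sup>+y. (\<integral>\<^sup>+x. ennreal (lo x y) * indicator B y * indicator A x \<partial>stat) \<partial>stat)"
    by (rule lo.pair.Fubini'[symmetric]) measurable
  also have "\<dots> = (\<integral>\<^sup>+y. (\<integral>\<^sup>+x. ennreal (lo y x) * indicator A x * indicator B y \<partial>stat) \<partial>stat)"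
    by (intro nn_integral_cong) (simp add: lo_def min.commute mult_ac)
  finally show "(\<integral>\<^sup>+x\<in>A. emeasure (P x) B \<partial>stat) = (\<integral>\<^sup>+y\<in>B. emeasure (P y) A \<partial>stat)"
    by (simp add: flow Int_commute)
qed

section \<open>Exchanging a chain and its time-reversal\<close>

text \<open>
  Reversing twice recovers \<open>p\<close>, up to the null set of points \<open>y\<close> with \<open>w y = 0\<close>.
\<close>

lemma transition_density_reversal:
  assumes q: "(\<lambda>(x, y). q x y) \<in> borel_measurable (\<mu> \<Otimes>\<^sub>M \<mu>)"
    and q_nonneg: "\<And>x y. x \<in> space \<mu> \<Longrightarrow> y \<in> space \<mu> \<Longrightarrow> 0 \<le> q x y"
    and q_eq: "\<And>x y. x \<in> space \<mu> \<Longrightarrow> y \<in> space \<mu> \<Longrightarrow> 0 < w x \<Longrightarrow> q x y = reversal_density w p x y"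
  shows "transition_density \<mu> w q"
proof (rule transition_density.intro)
  fix x assume x: "x \<in> space \<mu>" "0 < w x"
  have "(\<integral>\<^sup>+y. ennreal (q x y) \<partial>\<mu>) = (\<integral>\<^sup>+y. ennreal (reversal_density w p x y) \<partial>\<mu>)"
    using x by (intro nn_integral_cong) (simp add: q_eq)
  then show "(\<integral>\<^sup>+y. ennreal (q x y) \<partial>\<mu>) = 1"
    using mass_in[OF x] by simp
  have "AE y in \<mu>. reversal_density w q x y = p x y"
    using AE_w_pos AE_space
  proof eventually_elim
    case (elim y)
    have "reversal_density w q x y = w y * reversal_density w p y x / w x"
      using elim x by (simp add: reversal_density_def[of w q] q_eq)
    then show ?case
      using elim x by (simp add: reversal_density_def)
  qed
  then have "(\<integral>\<^sup>+y. ennreal (reversal_density w q x y) \<partial>\<mu>) = (\<integral>\<^sup>+y. ennreal (p x y) \<partial>\<mu>)"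
    by (intro nn_integral_cong_AE) (auto elim!: eventually_mono)
  then show "(\<integral>\<^sup>+y. ennreal (reversal_density w q x y) \<partial>\<mu>) = 1"
    using mass_out[OF x] by simp
qed (rule pi_sigma_finite w_measurable w_nonneg w_null q q_nonneg; assumption)+

lemma kernel_eq_refl_on_support:
  assumes "kernel_induces stat K T" and "\<And>x. x \<in> space \<mu> \<Longrightarrow> 0 < w x \<Longrightarrow> K x = L x"
  shows "kernel_eq stat K L"
proof -
  have "AE x in stat. K x = L x"
    using AE_stat_pos by eventually_elim (use assms(2) in blast)
  then have "AE x in stat. kernel_integrable K f x \<and> kernel_integrable L f x \<and> kernel_act K f x = kernel_act L f x"
    if "f \<in> L2 stat" for f
    using assms(1)[unfolded kernel_induces_def, rule_format, OF that]
    by eventually_elim (auto simp: kernel_integrable_def kernel_act_def)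
  then show ?thesis by (simp add: kernel_eq_def)
qed

text \<open>
  The density of \<open>q\<close> relative to the stationary measure is the transpose of \<open>u\<close>, and \<open>lo\<close>, \<open>hi\<close>,
  \<open>rej\<close> are unaffected by transposition.
\<close>

lemma MH_reversal_invariant:
  assumes q: "(\<lambda>(x, y). q x y) \<in> borel_measurable (\<mu> \<Otimes>\<^sub>M \<mu>)"
    and q_nonneg: "\<And>x y. x \<in> space \<mu> \<Longrightarrow> y \<in> space \<mu> \<Longrightarrow> 0 \<le> q x y"
    and q_eq: "\<And>x y. x \<in> space \<mu> \<Longrightarrow> y \<in> space \<mu> \<Longrightarrow> 0 < w x \<Longrightarrow> q x y = reversal_density w p x y"
  shows "kernel_eq stat (MH1 \<mu> w p) (MH1 \<mu> w q)" and "kernel_eq stat (MH2 \<mu> w p) (MH2 \<mu> w q)"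
proof -
  interpret q: transition_density \<mu> w q
    by (rule transition_density_reversal[OF q q_nonneg q_eq])
  have u_eq: "q.u x y = u y x" if "x \<in> space \<mu>" "y \<in> space \<mu>" "0 < w x" "0 < w y" for x y
    using that by (simp add: q.u_def q_eq reversal_density_div)
  have u_AE: "AE y in stat. q.lo x y = lo x y \<and> q.hi x y = hi x y" if x: "x \<in> space \<mu>" "0 < w x" for x
    using AE_stat_pos
    by eventually_elim (simp add: q.lo_def q.hi_def lo_def hi_def u_eq x min.commute max.commute)
  have dens: "density stat (\<lambda>y. ennreal (q.lo x y)) = density stat (\<lambda>y. ennreal (lo x y))"
      "density stat (\<lambda>y. ennreal (q.hi x y)) = density stat (\<lambda>y. ennreal (hi x y))"
      "q.rej x = rej x" if x: "x \<in> space \<mu>" "0 < w x" for x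
  proof -
    note [measurable] = lo_row[OF x(1)] hi_row[OF x(1)]
      q.lo_row[OF x(1)] q.hi_row[OF x(1)]
    have ae: "AE y in stat. q.lo x y = lo x y" "AE y in stat. q.hi x y = hi x y"
      by (rule eventually_mono[OF u_AE[OF x]], simp)+
    show "density stat (\<lambda>y. ennreal (q.lo x y)) = density stat (\<lambda>y. ennreal (lo x y))"
      using ae(1) by (intro density_cong) auto
    show "density stat (\<lambda>y. ennreal (q.hi x y)) = density stat (\<lambda>y. ennreal (hi x y))"
      using ae(2) by (intro density_cong) auto
    have "(LINT y|stat. q.lo x y) = (LINT y|stat. lo x y)"
      using ae(1) by (intro integral_cong_AE) auto
    then show "q.rej x = rej x"
      by (simp add: q.rej_def rej_def)
  qed
  show "kernel_eq stat (MH1 \<mu> w p) (MH1 \<mu> w q)"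
    by (rule kernel_eq_refl_on_support[OF induces_MH1])
       (simp add: MH1_eq q.MH1_eq signed_of_def dens)
  show "kernel_eq stat (MH2 \<mu> w p) (MH2 \<mu> w q)"
    by (rule kernel_eq_refl_on_support[OF induces_MH2])
       (simp add: MH2_eq q.MH2_eq dens)
qed

end

lemma mass_eq_1_if_density_of_kernel:
  assumes K: "K \<in> \<mu> \<rightarrow>\<^sub>M prob_algebra \<mu>" and x: "x \<in> space \<mu>"
    and dens: "K x = density \<mu> (\<lambda>y. ennreal (k y))" and k: "k \<in> borel_measurable \<mu>"
  shows "(\<integral>\<^sup>+y. ennreal (k y) \<partial>\<mu>) = 1"
proof -
  have "prob_space (K x)"
    using measurable_space[OF K x] by (simp add: space_prob_algebra)
  then have "emeasure (density \<mu> (\<lambda>y. ennreal (k y))) (space \<mu>) = 1"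
    using prob_space.emeasure_space_1[of "K x"] by (simp add: dens)
  then show ?thesis
    using k by (simp add: emeasure_density cong: nn_integral_cong_simp)
qed

theorem lemma3p1:
  fixes \<mu> \<pi> \<phi> :: "'a measure"
    and P Pstar :: "'a \<Rightarrow> 'a measure"
    and w :: "'a \<Rightarrow> real"
    and p pstar :: "'a \<Rightarrow> 'a \<Rightarrow> real"
  assumes P_kernel: "P \<in> \<mu> \<rightarrow>\<^sub>M prob_algebra \<mu>"
    and Pstar_kernel: "Pstar \<in> \<mu> \<rightarrow>\<^sub>M prob_algebra \<mu>"
    and irreducible: "phi_irreducible \<mu> \<phi> P"
    and pi_sigma_finite: "sigma_finite_measure \<pi>"
    and pi_stationary: "stationary \<pi> P"
    and Pstar_reversal: "time_reversal \<pi> P Pstar"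
    and w_measurable: "w \<in> borel_measurable \<mu>"
    and w_nonneg: "\<And>x. x \<in> space \<mu> \<Longrightarrow> 0 \<le> w x"
    and pi_density: "\<pi> = density \<mu> (\<lambda>x. ennreal (w x))"
    and w_null: "{x \<in> space \<mu>. w x = 0} \<in> null_sets \<mu>"
    and p_measurable: "(\<lambda>(x, y). p x y) \<in> borel_measurable (\<mu> \<Otimes>\<^sub>M \<mu>)"
    and p_nonneg: "\<And>x y. x \<in> space \<mu> \<Longrightarrow> y \<in> space \<mu> \<Longrightarrow> 0 \<le> p x y"
    and P_density: "\<And>x. x \<in> space \<mu> \<Longrightarrow> P x = density \<mu> (\<lambda>y. ennreal (p x y))"
    and pstar_measurable: "(\<lambda>(x, y). pstar x y) \<in> borel_measurable (\<mu> \<Otimes>\<^sub>M \<mu>)"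
    and pstar_nonneg: "\<And>x y. x \<in> space \<mu> \<Longrightarrow> y \<in> space \<mu> \<Longrightarrow> 0 \<le> pstar x y"
    and Pstar_density: "\<And>x. x \<in> space \<mu> \<Longrightarrow> Pstar x = density \<mu> (\<lambda>y. ennreal (pstar x y))"
    and pstar_formula: "\<And>x y. x \<in> space \<mu> \<Longrightarrow> y \<in> space \<mu> \<Longrightarrow> w x > 0 \<Longrightarrow>
                          pstar x y = reversal_density w p x y"
  shows "kernel_eq \<pi> (kernel_add (signed_of P) (signed_of Pstar))
                     (kernel_add (MH1 \<mu> w p) (MH2 \<mu> w p)) \<and>
         (\<forall>x\<in>space \<mu>. w x > 0 \<longrightarrow> kernel_mass (MH2 \<mu> w p) x (space \<mu>) = 1) \<and>
         (kernel_self_adjoint \<pi> (MH1 \<mu> w p) \<and> kernel_self_adjoint \<pi> (MH2 \<mu> w p)) \<and>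
         ((kernel_eq \<pi> (MH1 \<mu> w p) (MH2 \<mu> w p) \<and> kernel_eq \<pi> (MH2 \<mu> w p) (signed_of P))
            \<longleftrightarrow> reversible \<pi> P) \<and>
         (kernel_eq \<pi> (MH1 \<mu> w p) (MH1 \<mu> w pstar) \<and> kernel_eq \<pi> (MH2 \<mu> w p) (MH2 \<mu> w pstar))"
proof -
  have row: "k x \<in> borel_measurable \<mu>"
    if "(\<lambda>(x, y). k x y) \<in> borel_measurable (\<mu> \<Otimes>\<^sub>M \<mu>)" "x \<in> space \<mu>" for k :: "'a \<Rightarrow> 'a \<Rightarrow> real" and x
    using measurable_compose[OF measurable_Pair1'[OF that(2)] that(1)] by simp
  interpret transition_density \<mu> w p
  proof (rule transition_density.intro)
    fix x assume x: "x \<in> space \<mu>" "0 < w x"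
    show "(\<integral>\<^sup>+y. ennreal (p x y) \<partial>\<mu>) = 1"
      by (rule mass_eq_1_if_density_of_kernel[OF P_kernel x(1) P_density[OF x(1)] row[OF p_measurable x(1)]])
    have "(\<integral>\<^sup>+y. ennreal (pstar x y) \<partial>\<mu>) = 1"
      by (rule mass_eq_1_if_density_of_kernel[OF Pstar_kernel x(1) Pstar_density[OF x(1)] row[OF pstar_measurable x(1)]])
    moreover have "(\<integral>\<^sup>+y. ennreal (pstar x y) \<partial>\<mu>) = (\<integral>\<^sup>+y. ennreal (reversal_density w p x y) \<partial>\<mu>)"
      using x by (intro nn_integral_cong) (simp add: pstar_formula)
    ultimately show "(\<integral>\<^sup>+y. ennreal (reversal_density w p x y) \<partial>\<mu>) = 1"
      by simp
  qed (rule pi_sigma_finite[unfolded pi_density] w_nonneg w_null w_measurable p_measurable p_nonneg; assumption)+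
  have \<pi>: "\<pi> = stat"
    by (simp add: stat_def pi_density)
  have P: "\<forall>x\<in>space \<mu>. 0 < w x \<longrightarrow> P x = density \<mu> (\<lambda>y. ennreal (p x y))"
    by (simp add: P_density)
  have Pstar: "\<forall>x\<in>space \<mu>. 0 < w x \<longrightarrow> Pstar x = density \<mu> (\<lambda>y. ennreal (reversal_density w p x y))"
  proof (intro ballI impI)
    fix x assume x: "x \<in> space \<mu>" "0 < w x"
    show "Pstar x = density \<mu> (\<lambda>y. ennreal (reversal_density w p x y))"
      unfolding Pstar_density[OF x(1)]
      using row[OF pstar_measurable x(1)] reversal_row[OF x(1)] pstar_formula[OF x(1) _ x(2)]
      by (intro density_cong AE_I2) auto
  qed
  have reversible: "(kernel_eq stat (MH1 \<mu> w p) (MH2 \<mu> w p) \<and> kernel_eq stat (MH2 \<mu> w p) (signed_of P))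
      \<longleftrightarrow> reversible stat P"
  proof
    assume "kernel_eq stat (MH1 \<mu> w p) (MH2 \<mu> w p) \<and> kernel_eq stat (MH2 \<mu> w p) (signed_of P)"
    then have "kernel_eq stat (MH1 \<mu> w p) (signed_of P)"
      using kernel_eq_trans by blast
    then show "reversible stat P"
      by (rule MH1_eq_imp_reversible[OF P])
  next
    assume "reversible stat P"
    note sym = reversible_imp_symmetric[OF P this]
    show "kernel_eq stat (MH1 \<mu> w p) (MH2 \<mu> w p) \<and> kernel_eq stat (MH2 \<mu> w p) (signed_of P)"
      using symmetric_imp_MH_eq[OF P sym] kernel_eq_trans kernel_eq_sym by blast
  qed
  show ?thesis
    unfolding \<pi>
    using MH_sum[OF P Pstar] MH2_mass MH1_self_adjoint MH2_self_adjoint reversible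
      MH_reversal_invariant[OF pstar_measurable pstar_nonneg pstar_formula]
    by simp
qed

end
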